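(* Let $F=(F,\mathcal T,\nu,\mathcal G)$ be a $\nu$-archimedean, $\nu$-bipotent $\nu$-semifield$^\dagger$. Every principal $\nu$-kernel $\langle f\rangle$ of $F(\lambda_1,\dots,\lambda_n)$ can be written as the intersection of finitely many principal $\nu$-kernels $$\{K_i: i=1,\dots,q\}\quad\text{and}\quad\{N_j: j=1,\dots,m\},$$ where each $K_i$ is the product of an HS-kernel $L_i$ and a region $\nu$-kernel $R_i$, $$K_i=L_iR_i=\prod_{j=1}^{t_i}L_{i,j}\prod_{k=1}^{k_i}\mathcal O_{i,k}$$ with $L_{i,j}$ HP-kernels and $\mathcal O_{i,k}$ order $\nu$-kernels, while each $N_j$ is a product of bounded from below $\nu$-kernels and (complementary) region $\nu$-kernels. If $\langle f\rangle\in\mathcal P(\langle F\rangle)$, i.e. $\langle f\rangle\subseteq\langle F\rangle$, the $N_j$ can be replaced by $\langle F\rangle$ without affecting the resulting $\nu$-kernel.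
   Context: **$\nu$-structures.** A semiring$^\dagger$ is a commutative semiring with unit $1$, not required to have a zero (and containing $r_0,r_1$ with $r_0+r_1=1$). A $\nu$-domain$^\dagger$ is a quadruple $(R,\mathcal T,\nu,\mathcal G)$ with $R$ a semiring$^\dagger$, $\mathcal T\subset R$ a cancellative multiplicative submonoid (tangible elements), $\mathcal G$ an ideal of $R$ (ghost elements) with a partial order, and $\nu:R\to\mathcal G$ an idempotent homomorphism with $\nu|_{\mathcal T}$ onto, such that $a+b=a$ if $\nu(a)>\nu(b)$ and $a+b=\nu(a)$ if $\nu(a)=\nu(b)$. It is a $\nu$-semifield$^\dagger$ if $\mathcal T$ is an abelian group, $\nu$-bipotent if $a+b\in\{a,b,a^\nu\}$ always, $\nu$-archimedean if $a^{k}\le_\nu b$ for all $k\in\mathbb Z$ implies $a\cong_\nu1$. Write $a^\nu=\nu(a)$; $a\cong_\nu b$ means $a^\nu=b^\nu$; $a\ge_\nu b$ means $a^\nu\ge b^\nu$. Set $a^*=a^{-1}$, $(a^\nu)^*=(a^{-1})^\nu$ for $a\in\mathcal T$, and $|a|=a+a^*$; these apply to functions pointwise. **Rational functions and kernels.** $F(\lambda_1,\dots,\lambda_n)$ consists of the functions $F^{(n)}\to F$, $\mathbf a\mapsto h(\mathbf a)g(\mathbf a)^*$, with $h$ a polynomial over $F$ and $g$ a polynomial with tangible coefficients, with pointwise operations. A $\nu$-kernel is a subgroup $K$ (closed under products and $*$) such that $a,b\in K$, $\alpha+\beta\cong_\nu1$ imply $\alpha a+\beta b\in K$; these are handled up to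 $\cong_\nu$. $\langle S\rangle$ is the $\nu$-kernel generated by $S$; principal means generated by one element; $K_1K_2=\{ab:a\in K_1,b\in K_2\}$. $\langle F\rangle$ is the $\nu$-kernel generated by the constants; $\mathcal P(\langle F\rangle)$ is the set of principal $\nu$-kernels contained in it. Write $f\sim f'$ if $\langle f\rangle\cap\langle F\rangle=\langle f'\rangle\cap\langle F\rangle$. $1_{\mathrm{loc}}(f)=\{\mathbf a: f(\mathbf a)\cong_\nu1\}$. **Special kernels.** An $\mathscr L$-monomial is a non-constant Laurent monomial. An HP-kernel is a $\nu$-kernel generated by an $\mathscr L$-monomial. An HS-fraction is an $f\sim\sum_{i=1}^t|f_i|$ with $f_i$ non-proportional $\mathscr L$-monomials; an HS-kernel is a principal $\nu$-kernel generated by an HS-fraction (a product of HP-kernels). An order $\nu$-kernel is $\langle1+f\rangle$ with $f$ an $\mathscr L$-monomial; its complementary order $\nu$-kernel is $\langle1+f^{-1}\rangle$. A region fraction is an $f$ such that $1_{\mathrm{loc}}(f)$ contains a nonempty open interval; a region $\nu$-kernel is a principal $\nu$-kernel generated by a region fraction; the region $\nu$-kernels are those of the form $\prod_i\mathcal O_i$ with $\mathcal O_i$ order $\nu$-kernels. A $\nu$-kernel is bounded from below if it is generated by some $g$ with $|g|\ge_\nu\alpha$ for some $\alpha>_\nu1$ in $F$. Factors may be trivial (empty products allowed).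
   Formalization: The partial order on the ghost ideal is taken to be the natural one (g ≤ h iff g + h = h); with an arbitrary partial order satisfying the stated axioms, e.g. the discrete order, the claim fails for the ν-kernel of a nontrivial constant. *)

theory Defs
  imports Main
begin

text \<open>
  A semiring without the requirement of a zero is a type of class \<open>comm_semiring\<close> and
  \<open>comm_monoid_mult\<close>. The remaining data (tangible elements, ghost elements, ghost map, partial
  order on the ghosts) form a record over that type.
\<close>

record 'a nu_structure =
  tangible :: "'a set"
  ghost :: "'a set"
  nu :: "'a \<Rightarrow> 'a"
  ghost_le :: "'a \<Rightarrow> 'a \<Rightarrow> bool"

definition nu_cong :: "('a, 'z) nu_structure_scheme \<Rightarrow> 'a \<Rightarrow> 'a \<Rightarrow> bool" where
  "nu_cong F a b \<longleftrightarrow> nu F a = nu F b"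

definition nu_le :: "('a, 'z) nu_structure_scheme \<Rightarrow> 'a \<Rightarrow> 'a \<Rightarrow> bool" where
  "nu_le F a b \<longleftrightarrow> ghost_le F (nu F a) (nu F b)"

definition nu_less :: "('a, 'z) nu_structure_scheme \<Rightarrow> 'a \<Rightarrow> 'a \<Rightarrow> bool" where
  "nu_less F a b \<longleftrightarrow> nu_le F a b \<and> \<not> nu_cong F a b"

text \<open>
  The partial order on the ghost ideal is the natural order of this additively idempotent semiring:
  \<open>g \<le> h\<close> iff \<open>g + h = h\<close>. The axiom that \<open>a + b = a\<close> for \<open>\<nu> a > \<nu> b\<close> gives only one direction of
  this; without the other one the discrete order would be admitted and the \<open>\<nu>\<close>-order would carry
  no information.
\<close>

definition nu_domain :: "('a::{comm_semiring, comm_monoid_mult}, 'z) nu_structure_scheme \<Rightarrow> bool" where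
  "nu_domain F \<longleftrightarrow>
     (\<exists>r0 r1 :: 'a. r0 + r1 = 1) \<and>
     1 \<in> tangible F \<and>
     (\<forall>a\<in>tangible F. \<forall>b\<in>tangible F. a * b \<in> tangible F) \<and>
     (\<forall>a\<in>tangible F. \<forall>b\<in>tangible F. \<forall>c\<in>tangible F. a * b = a * c \<longrightarrow> b = c) \<and>
     (\<forall>g\<in>ghost F. \<forall>h\<in>ghost F. g + h \<in> ghost F) \<and>
     (\<forall>r. \<forall>g\<in>ghost F. r * g \<in> ghost F) \<and>
     reflp_on (ghost F) (ghost_le F) \<and>
     transp_on (ghost F) (ghost_le F) \<and>
     antisymp_on (ghost F) (ghost_le F) \<and>
     (\<forall>g\<in>ghost F. \<forall>h\<in>ghost F. ghost_le F g h \<longleftrightarrow> g + h = h) \<and>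
     range (nu F) \<subseteq> ghost F \<and>
     (\<forall>a. nu F (nu F a) = nu F a) \<and>
     (\<forall>a b. nu F (a + b) = nu F a + nu F b) \<and>
     (\<forall>a b. nu F (a * b) = nu F a * nu F b) \<and>
     nu F ` tangible F = ghost F \<and>
     (\<forall>a b. nu_less F b a \<longrightarrow> a + b = a) \<and>
     (\<forall>a b. nu_cong F a b \<longrightarrow> a + b = nu F a)"

definition nu_semifield :: "('a::{comm_semiring, comm_monoid_mult}, 'z) nu_structure_scheme \<Rightarrow> bool" where
  "nu_semifield F \<longleftrightarrow> nu_domain F \<and> (\<forall>a\<in>tangible F. \<exists>b\<in>tangible F. a * b = 1)"

definition nu_bipotent :: "('a::plus, 'z) nu_structure_scheme \<Rightarrow> bool" where
  "nu_bipotent F \<longleftrightarrow> (\<forall>a b. a + b \<in> {a, b, nu F a})"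

definition tangible_inverse :: "('a::comm_monoid_mult, 'z) nu_structure_scheme \<Rightarrow> 'a \<Rightarrow> 'a" where
  "tangible_inverse F a = (THE b. b \<in> tangible F \<and> a * b = 1)"

text \<open>
  The second branch is \<open>(\<nu> t)\<^sup>* = \<nu> (t\<^sup>-\<^sup>1)\<close> for tangible \<open>t\<close>, up to \<open>\<nu>\<close> independent of the choice
  of \<open>t\<close>; elements that are neither tangible nor ghost, which the axioms do not exclude, are treated
  like their ghost.
\<close>

definition star :: "('a::comm_monoid_mult, 'z) nu_structure_scheme \<Rightarrow> 'a \<Rightarrow> 'a" where
  "star F a =
     (if a \<in> tangible F then tangible_inverse F a
      else nu F (tangible_inverse F (SOME t. t \<in> tangible F \<and> nu F t = nu F a)))"

definition nu_abs :: "('a::{comm_semiring, comm_monoid_mult}, 'z) nu_structure_scheme \<Rightarrow> 'a \<Rightarrow> 'a" where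
  "nu_abs F a = a + star F a"

definition zpow :: "('a::comm_monoid_mult, 'z) nu_structure_scheme \<Rightarrow> 'a \<Rightarrow> int \<Rightarrow> 'a" where
  "zpow F a k = (if 0 \<le> k then a ^ nat k else star F a ^ nat (- k))"

definition nu_archimedean :: "('a::comm_monoid_mult, 'z) nu_structure_scheme \<Rightarrow> bool" where
  "nu_archimedean F \<longleftrightarrow> (\<forall>a b. (\<forall>k. nu_le F (zpow F a k) b) \<longrightarrow> nu_cong F a 1)"


text \<open>
  Points of \<open>F\<^sup>(\<^sup>n\<^sup>)\<close> are functions \<open>'n \<Rightarrow> 'a\<close> on a finite index type with \<open>n\<close> elements.
  In the absence of a zero only nonempty sums make sense.
\<close>

fun ne_sum :: "'a::plus list \<Rightarrow> 'a" where
  "ne_sum [x] = x"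
| "ne_sum (x # y # zs) = x + ne_sum (y # zs)"

definition polynomial_funs ::
    "'a::{comm_semiring, comm_monoid_mult} set \<Rightarrow> (('n::finite \<Rightarrow> 'a) \<Rightarrow> 'a) set" where
  "polynomial_funs C =
     {p. \<exists>ms :: ('a \<times> ('n \<Rightarrow> nat)) list. ms \<noteq> [] \<and> distinct (map snd ms) \<and> fst ` set ms \<subseteq> C \<and>
         p = (\<lambda>x. ne_sum (map (\<lambda>(c, e). c * (\<Prod>i\<in>UNIV. x i ^ e i)) ms))}"

definition rational_funs ::
    "('a::{comm_semiring, comm_monoid_mult}, 'z) nu_structure_scheme \<Rightarrow> (('n::finite \<Rightarrow> 'a) \<Rightarrow> 'a) set" where
  "rational_funs F =
     {f. \<exists>h\<in>polynomial_funs UNIV. \<exists>g\<in>polynomial_funs (tangible F). f = (\<lambda>x. h x * star F (g x))}"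

definition fun_cong :: "('a, 'z) nu_structure_scheme \<Rightarrow> ('p \<Rightarrow> 'a) \<Rightarrow> ('p \<Rightarrow> 'a) \<Rightarrow> bool" where
  "fun_cong F f g \<longleftrightarrow> (\<forall>x. nu_cong F (f x) (g x))"

text \<open>
  Kernels are handled up to \<open>\<nu>\<close>-congruence: they are represented by sets of rational functions closed
  under \<open>\<nu>\<close>-congruence. Accordingly a function belongs to a kernel if all rational functions
  \<open>\<nu>\<close>-congruent to it do, and all closure conditions, generation and products are read in this sense.
\<close>

definition nu_mem ::
    "('a::{comm_semiring, comm_monoid_mult}, 'z) nu_structure_scheme \<Rightarrow>
     (('n::finite \<Rightarrow> 'a) \<Rightarrow> 'a) \<Rightarrow> (('n \<Rightarrow> 'a) \<Rightarrow> 'a) set \<Rightarrow> bool" where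
  "nu_mem F f K \<longleftrightarrow> (\<forall>h\<in>rational_funs F. fun_cong F h f \<longrightarrow> h \<in> K)"

definition nu_kernel ::
    "('a::{comm_semiring, comm_monoid_mult}, 'z) nu_structure_scheme \<Rightarrow>
     (('n::finite \<Rightarrow> 'a) \<Rightarrow> 'a) set \<Rightarrow> bool" where
  "nu_kernel F K \<longleftrightarrow>
     K \<subseteq> rational_funs F \<and> K \<noteq> {} \<and>
     (\<forall>a\<in>K. \<forall>b\<in>K. nu_mem F (\<lambda>x. a x * b x) K) \<and>
     (\<forall>a\<in>K. nu_mem F (\<lambda>x. star F (a x)) K) \<and>
     (\<forall>a\<in>K. \<forall>b\<in>K. \<forall>\<alpha>\<in>rational_funs F. \<forall>\<beta>\<in>rational_funs F.
        fun_cong F (\<lambda>x. \<alpha> x + \<beta> x) (\<lambda>x. 1) \<longrightarrow> nu_mem F (\<lambda>x. \<alpha> x * a x + \<beta> x * b x) K)"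

definition kernel_gen ::
    "('a::{comm_semiring, comm_monoid_mult}, 'z) nu_structure_scheme \<Rightarrow>
     (('n::finite \<Rightarrow> 'a) \<Rightarrow> 'a) set \<Rightarrow> (('n \<Rightarrow> 'a) \<Rightarrow> 'a) set" where
  "kernel_gen F S = \<Inter>{K. nu_kernel F K \<and> (\<forall>f\<in>S. nu_mem F f K)}"

definition principal_kernel ::
    "('a::{comm_semiring, comm_monoid_mult}, 'z) nu_structure_scheme \<Rightarrow>
     (('n::finite \<Rightarrow> 'a) \<Rightarrow> 'a) set \<Rightarrow> bool" where
  "principal_kernel F K \<longleftrightarrow> (\<exists>f\<in>rational_funs F. K = kernel_gen F {f})"

definition const_kernel ::
    "('a::{comm_semiring, comm_monoid_mult}, 'z) nu_structure_scheme \<Rightarrow>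
     (('n::finite \<Rightarrow> 'a) \<Rightarrow> 'a) set" where
  "const_kernel F = kernel_gen F (range (\<lambda>c x. c))"

definition kernel_mult ::
    "('a::{comm_semiring, comm_monoid_mult}, 'z) nu_structure_scheme \<Rightarrow>
     (('n::finite \<Rightarrow> 'a) \<Rightarrow> 'a) set \<Rightarrow> (('n \<Rightarrow> 'a) \<Rightarrow> 'a) set \<Rightarrow> (('n \<Rightarrow> 'a) \<Rightarrow> 'a) set" where
  "kernel_mult F K1 K2 =
     {h \<in> rational_funs F. \<exists>a\<in>K1. \<exists>b\<in>K2. fun_cong F h (\<lambda>x. a x * b x)}"

definition kernel_prod ::
    "('a::{comm_semiring, comm_monoid_mult}, 'z) nu_structure_scheme \<Rightarrow>
     (('n::finite \<Rightarrow> 'a) \<Rightarrow> 'a) set list \<Rightarrow> (('n \<Rightarrow> 'a) \<Rightarrow> 'a) set" where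
  "kernel_prod F Ks = foldr (kernel_mult F) Ks (kernel_gen F {\<lambda>x. 1})"

definition frac_equiv ::
    "('a::{comm_semiring, comm_monoid_mult}, 'z) nu_structure_scheme \<Rightarrow>
     (('n::finite \<Rightarrow> 'a) \<Rightarrow> 'a) \<Rightarrow> (('n \<Rightarrow> 'a) \<Rightarrow> 'a) \<Rightarrow> bool" where
  "frac_equiv F f g \<longleftrightarrow>
     kernel_gen F {f} \<inter> const_kernel F = kernel_gen F {g} \<inter> const_kernel F"

definition one_loc :: "('a::comm_monoid_mult, 'z) nu_structure_scheme \<Rightarrow> ('p \<Rightarrow> 'a) \<Rightarrow> 'p set" where
  "one_loc F f = {x. nu_cong F (f x) 1}"


definition L_monomial ::
    "('a::{comm_semiring, comm_monoid_mult}, 'z) nu_structure_scheme \<Rightarrow>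
     (('n::finite \<Rightarrow> 'a) \<Rightarrow> 'a) \<Rightarrow> bool" where
  "L_monomial F f \<longleftrightarrow>
     (\<exists>c. \<exists>e :: 'n \<Rightarrow> int. (\<exists>i. e i \<noteq> 0) \<and> f = (\<lambda>x. c * (\<Prod>i\<in>UNIV. zpow F (x i) (e i))))"

definition proportional ::
    "('a::{comm_semiring, comm_monoid_mult}, 'z) nu_structure_scheme \<Rightarrow>
     (('n::finite \<Rightarrow> 'a) \<Rightarrow> 'a) \<Rightarrow> (('n \<Rightarrow> 'a) \<Rightarrow> 'a) \<Rightarrow> bool" where
  "proportional F f g \<longleftrightarrow> (\<exists>c. fun_cong F f (\<lambda>x. c * g x))"

definition HP_kernel ::
    "('a::{comm_semiring, comm_monoid_mult}, 'z) nu_structure_scheme \<Rightarrow>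
     (('n::finite \<Rightarrow> 'a) \<Rightarrow> 'a) set \<Rightarrow> bool" where
  "HP_kernel F K \<longleftrightarrow> (\<exists>f. L_monomial F f \<and> K = kernel_gen F {f})"

definition HS_fraction ::
    "('a::{comm_semiring, comm_monoid_mult}, 'z) nu_structure_scheme \<Rightarrow>
     (('n::finite \<Rightarrow> 'a) \<Rightarrow> 'a) \<Rightarrow> bool" where
  "HS_fraction F f \<longleftrightarrow> f \<in> rational_funs F \<and>
     (\<exists>fs. fs \<noteq> [] \<and> (\<forall>g\<in>set fs. L_monomial F g) \<and>
        (\<forall>i<length fs. \<forall>j<length fs. i \<noteq> j \<longrightarrow> \<not> proportional F (fs ! i) (fs ! j)) \<and>
        frac_equiv F f (\<lambda>x. ne_sum (map (\<lambda>g. nu_abs F (g x)) fs)))"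

definition HS_kernel ::
    "('a::{comm_semiring, comm_monoid_mult}, 'z) nu_structure_scheme \<Rightarrow>
     (('n::finite \<Rightarrow> 'a) \<Rightarrow> 'a) set \<Rightarrow> bool" where
  "HS_kernel F K \<longleftrightarrow> (\<exists>f. HS_fraction F f \<and> K = kernel_gen F {f})"

definition order_kernel ::
    "('a::{comm_semiring, comm_monoid_mult}, 'z) nu_structure_scheme \<Rightarrow>
     (('n::finite \<Rightarrow> 'a) \<Rightarrow> 'a) set \<Rightarrow> bool" where
  "order_kernel F K \<longleftrightarrow> (\<exists>f. L_monomial F f \<and> K = kernel_gen F {\<lambda>x. 1 + f x})"

definition open_interval ::
    "('a, 'z) nu_structure_scheme \<Rightarrow> ('n \<Rightarrow> 'a) \<Rightarrow> ('n \<Rightarrow> 'a) \<Rightarrow> ('n \<Rightarrow> 'a) set" where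
  "open_interval F a b = {x. \<forall>i. nu_less F (a i) (x i) \<and> nu_less F (x i) (b i)}"

definition region_fraction ::
    "('a::{comm_semiring, comm_monoid_mult}, 'z) nu_structure_scheme \<Rightarrow>
     (('n::finite \<Rightarrow> 'a) \<Rightarrow> 'a) \<Rightarrow> bool" where
  "region_fraction F f \<longleftrightarrow> f \<in> rational_funs F \<and>
     (\<exists>a b. open_interval F a b \<noteq> {} \<and> open_interval F a b \<subseteq> one_loc F f)"

text \<open>
  Both descriptions of region kernels are required, as neither implies the other. Complementary order
  kernels \<open>\<langle>1 + f\<^sup>-\<^sup>1\<rangle>\<close> are order kernels, since \<open>f\<^sup>-\<^sup>1\<close> is again an \<open>L\<close>-monomial, so this also covers
  the complementary region kernels.
\<close>

definition region_kernel ::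
    "('a::{comm_semiring, comm_monoid_mult}, 'z) nu_structure_scheme \<Rightarrow>
     (('n::finite \<Rightarrow> 'a) \<Rightarrow> 'a) set \<Rightarrow> bool" where
  "region_kernel F R \<longleftrightarrow>
     (\<exists>f. region_fraction F f \<and> R = kernel_gen F {f}) \<and>
     (\<exists>Os. (\<forall>K\<in>set Os. order_kernel F K) \<and> R = kernel_prod F Os)"

definition bounded_below_kernel ::
    "('a::{comm_semiring, comm_monoid_mult}, 'z) nu_structure_scheme \<Rightarrow>
     (('n::finite \<Rightarrow> 'a) \<Rightarrow> 'a) set \<Rightarrow> bool" where
  "bounded_below_kernel F K \<longleftrightarrow>
     (\<exists>g\<in>rational_funs F. K = kernel_gen F {g} \<and>
        (\<exists>\<alpha>. nu_less F 1 \<alpha> \<and> (\<forall>x. nu_le F \<alpha> (nu_abs F (g x)))))"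

end

theory Submission
  imports Defs Complex_Main
begin

text \<open>
  Up to \<open>\<nu>\<close>, the structure is a totally ordered archimedean group, so by Hoelder's theorem it has a
  valuation into the reals turning products into sums and sums into maxima. Rational functions become
  differences of tropical polynomials, and the kernel generated by \<open>f\<close> consists of the rational \<open>h\<close>
  with \<open>\<bar>h\<bar> \<le> k \<bar>f\<bar>\<close> for some \<open>k\<close>; products of kernels correspond to \<open>\<bar>f\<bar> + \<bar>g\<bar>\<close> and
  finite intersections to minima.

  Write \<open>f = max\<^sub>i p\<^sub>i - max\<^sub>j q\<^sub>j\<close> additively, with monomials \<open>p\<^sub>i\<close> and \<open>q\<^sub>j\<close>. Then \<open>\<bar>f\<bar>\<close> is the
  minimum over the pairs \<open>(i, j)\<close> of
  \<open>\<bar>p\<^sub>i - q\<^sub>j\<bar> + \<Sum>\<^sub>k max 0 (p\<^sub>k - p\<^sub>i) + \<Sum>\<^sub>k max 0 (q\<^sub>k - q\<^sub>j)\<close>, attained where \<open>p\<^sub>i\<close> and \<open>q\<^sub>j\<close>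
  dominate. The first summand generates an HP-kernel, or a kernel of constants if \<open>p\<^sub>i\<close> and \<open>q\<^sub>j\<close> have
  the same exponents, and the others generate order kernels. Pairs whose region of domination contains
  no open interval can be left out, since the remaining regions still cover all points.
\<close>

section \<open>Archimedean ordered groups\<close>

text \<open>A preorder, with inverses only up to equivalence, because the \<open>\<nu>\<close>-order
  does not distinguish elements with the same ghost.\<close>

locale archimedean_preordered_group =
  fixes le :: "'a::comm_monoid_mult \<Rightarrow> 'a \<Rightarrow> bool" (infix "\<preceq>" 50)
  assumes trans: "a \<preceq> b \<Longrightarrow> b \<preceq> c \<Longrightarrow> a \<preceq> c"
    and total: "a \<preceq> b \<or> b \<preceq> a"
    and mult_right: "a \<preceq> b \<Longrightarrow> a * c \<preceq> b * c"
    and inverse: "\<exists>b. a * b \<preceq> 1 \<and> 1 \<preceq> a * b"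
    and archimedean: "1 \<preceq> a \<Longrightarrow> (\<And>n::nat. a ^ n \<preceq> b) \<Longrightarrow> a \<preceq> 1"
begin

lemma refl: "a \<preceq> a"
  using total by blast

lemma mult_mono: "a \<preceq> b \<Longrightarrow> c \<preceq> d \<Longrightarrow> a * c \<preceq> b * d"
  by (metis mult_right trans mult.commute)

lemma mult_cancel: assumes "a * c \<preceq> b * c" shows "a \<preceq> b"
proof -
  obtain d where d: "c * d \<preceq> 1" "1 \<preceq> c * d" using inverse by blast
  have "a \<preceq> a * (c * d)" using mult_mono[OF refl d(2)] by (metis mult.right_neutral)
  moreover have "a * (c * d) \<preceq> b * (c * d)" using mult_right[OF assms, of d] by (simp add: mult.assoc)
  moreover have "b * (c * d) \<preceq> b" using mult_mono[OF refl d(1)] by (metis mult.right_neutral)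
  ultimately show ?thesis using trans by blast
qed

lemma power_mono: "a \<preceq> b \<Longrightarrow> a ^ n \<preceq> b ^ n"
  by (induction n) (auto intro: refl mult_mono)

end

section \<open>Hoelder's embedding by rational cuts\<close>

locale archimedean_preordered_group_unit = archimedean_preordered_group +
  fixes u :: "'a::comm_monoid_mult"
  assumes unit: "\<not> u \<preceq> 1"
begin

lemma unit_ge: "1 \<preceq> u"
  using unit total by blast

lemma unit_power_leD: assumes "u ^ i \<preceq> u ^ j" shows "i \<le> j"
proof (rule ccontr)
  assume "\<not> i \<le> j"
  then have k: "i = Suc (i - Suc j) + j" by simp
  define k where "k = i - Suc j"
  have "u ^ Suc k * u ^ j \<preceq> 1 * u ^ j" using assms unfolding k_def power_add[symmetric] k[symmetric] by simp
  then have "u ^ Suc k \<preceq> 1" by (rule mult_cancel)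
  moreover have "u * 1 ^ k \<preceq> u * u ^ k" by (intro mult_mono power_mono refl unit_ge)
  ultimately show False using unit trans by auto
qed

text \<open>Otherwise all powers of \<open>u\<close> lie below \<open>a\<close>, and the archimedean
  axiom forces \<open>u \<preceq> 1\<close>.\<close>

lemma unit_dominates: "\<exists>n. a \<preceq> u ^ n"
  using archimedean[OF unit_ge] unit total by blast

text \<open>The integral exponent of \<open>u\<close> is split as \<open>p - p'\<close>, which avoids inverses.\<close>

definition cut :: "'a \<Rightarrow> real set" where
  "cut a = {(real p - real p') / real q | p p' q. q > 0 \<and> u ^ p \<preceq> a ^ q * u ^ p'}"

text \<open>Hoelder's real value of \<open>a\<close> on the scale with unit
  \<open>u\<close>.\<close>

definition height :: "'a \<Rightarrow> real" where
  "height a = Sup (cut a)"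

lemma cutI: "q > 0 \<Longrightarrow> u ^ p \<preceq> a ^ q * u ^ p' \<Longrightarrow> (real p - real p') / real q \<in> cut a"
  unfolding cut_def by blast

lemma cutE:
  assumes "r \<in> cut a"
  obtains p p' q where "r = (real p - real p') / real q" "q > 0" "u ^ p \<preceq> a ^ q * u ^ p'"
  using assms unfolding cut_def mem_Collect_eq by (elim exE conjE) (rule that)

lemma bdd_above_cut: "bdd_above (cut a)"
proof -
  obtain n where n: "a \<preceq> u ^ n" using unit_dominates by blast
  show ?thesis
  proof (rule bdd_aboveI)
    fix r assume "r \<in> cut a"
    then obtain p p' q where r: "r = (real p - real p') / real q" "q > 0" "u ^ p \<preceq> a ^ q * u ^ p'"
      by (rule cutE)
    have "u ^ p \<preceq> (u ^ n) ^ q * u ^ p'"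
      using trans[OF r(3) mult_right[OF power_mono[OF n]]] .
    then have "p \<le> n * q + p'" by (intro unit_power_leD) (simp add: power_add power_mult)
    then have "real p \<le> real n * real q + real p'" by (metis of_nat_add of_nat_le_iff of_nat_mult)
    then show "r \<le> real n" unfolding r(1) using r(2) by (simp add: field_simps)
  qed
qed

text \<open>A power \<open>u ^ n\<close> above an inverse of \<open>a\<close> puts
  \<open>- n\<close> into the cut.\<close>

lemma cut_nonempty: "cut a \<noteq> {}"
proof -
  obtain b where b: "1 \<preceq> a * b" using inverse by blast
  obtain n where "b \<preceq> u ^ n" using unit_dominates by blast
  then have "u ^ 0 \<preceq> a ^ 1 * u ^ n" using b mult_mono[OF refl] trans by (metis power_0 power_one_right)
  from cutI[OF _ this] show ?thesis by auto
qed

lemma le_height: "r \<in> cut a \<Longrightarrow> r \<le> height a"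
  unfolding height_def by (rule cSup_upper[OF _ bdd_above_cut])

lemma height_mono: "a \<preceq> b \<Longrightarrow> height a \<le> height b"
  unfolding height_def
proof (rule cSup_subset_mono[OF cut_nonempty bdd_above_cut], rule subsetI)
  fix r assume ab: "a \<preceq> b" and "r \<in> cut a"
  from this(2) obtain p p' q where r: "r = (real p - real p') / real q" "q > 0" "u ^ p \<preceq> a ^ q * u ^ p'"
      by (rule cutE)
  have "u ^ p \<preceq> b ^ q * u ^ p'" using trans[OF r(3) mult_right[OF power_mono[OF ab]]] .
  then show "r \<in> cut b" using cutI r by simp
qed

text \<open>With the common denominator \<open>q * k\<close>, the defining inequalities of two
  fractions multiply, so elements of the two cuts add up to an element of the cut of
  \<open>a * b\<close>; the suprema are then taken one after the other.\<close>

lemma height_superadditive: "height a + height b \<le> height (a * b)"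
proof -
  have "r + s \<le> height (a * b)" if "r \<in> cut a" "s \<in> cut b" for r s
  proof -
    obtain p p' q where r: "r = (real p - real p') / real q" "q > 0" "u ^ p \<preceq> a ^ q * u ^ p'"
      using cutE[OF \<open>r \<in> cut a\<close>] .
    obtain l l' k where s: "s = (real l - real l') / real k" "k > 0" "u ^ l \<preceq> b ^ k * u ^ l'"
      using cutE[OF \<open>s \<in> cut b\<close>] .
    have "(u ^ p) ^ k * (u ^ l) ^ q \<preceq> (a ^ q * u ^ p') ^ k * (b ^ k * u ^ l') ^ q"
      by (intro mult_mono power_mono r s)
    then have "u ^ (p * k + l * q) \<preceq> (a * b) ^ (q * k) * u ^ (p' * k + l' * q)"
      by (simp only: power_add power_mult_distrib power_mult[symmetric] mult.commute[of k q] mult.assoc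
            mult.left_commute[of "u ^ (p' * k)"])
    from le_height[OF cutI[OF _ this]] r s
    have "(real (p * k + l * q) - real (p' * k + l' * q)) / real (q * k) \<le> height (a * b)" by simp
    moreover have "(real (p * k + l * q) - real (p' * k + l' * q)) / real (q * k) = r + s"
      unfolding r(1) s(1) using r(2) s(2) by (simp add: field_simps)
    ultimately show ?thesis by simp
  qed
  then have "height a \<le> height (a * b) - s" if "s \<in> cut b" for s
    unfolding height_def[of a] using that by (intro cSup_least[OF cut_nonempty]) (simp add: le_diff_eq)
  then have "height b \<le> height (a * b) - height a"
    unfolding height_def[of b] by (intro cSup_least[OF cut_nonempty]) (simp add: le_diff_eq add.commute)
  then show ?thesis by simp
qed

lemma height_one: "height 1 = 0"
proof -
  have "r \<le> 0" if r1: "r \<in> cut 1" for r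
  proof -
    obtain p p' q where r: "r = (real p - real p') / real q" "q > 0" "u ^ p \<preceq> 1 ^ q * u ^ p'"
      using cutE[OF r1] .
    then have "p \<le> p'" using unit_power_leD by simp
    then show ?thesis unfolding r(1) using r(2) by (simp add: divide_nonpos_pos)
  qed
  then have "height 1 \<le> 0" unfolding height_def by (intro cSup_least[OF cut_nonempty])
  moreover have "0 \<le> height 1" using le_height[OF cutI[of 1 0 1 0]] refl by simp
  ultimately show ?thesis by simp
qed

text \<open>One inequality is superadditivity. For the other, a rational strictly between
  \<open>height a\<close> and \<open>- height b\<close> lies outside the cut of \<open>a\<close>; by
  totality the reversed inequality holds, and multiplying it by \<open>b ^ q\<close> puts the
  negated rational into the cut of \<open>b\<close>.\<close>

lemma height_inverse: assumes "a * b \<preceq> 1" "1 \<preceq> a * b" shows "height b = - height a"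
proof (rule antisym)
  have "height a + height b \<le> 0" using height_superadditive height_mono[OF assms(1)] height_one by (metis order_trans)
  then show "height b \<le> - height a" by simp
next
  show "- height a \<le> height b"
  proof (rule ccontr)
    assume "\<not> - height a \<le> height b"
    then have "height a < - height b" by simp
    then obtain r where "r \<in> \<rat>" and r: "height a < r" "r < - height b" using Rats_dense_in_real by blast
    then obtain i :: int and q :: nat where q: "q > 0" "r = of_int i / of_nat q"
      by (metis Rats_cases' of_int_of_nat_eq pos_int_cases of_nat_0_less_iff)
    obtain p p' :: nat where "i = int p - int p'" by (metis int_diff_cases)
    then have rr: "r = (real p - real p') / real q" using q by simp
    have "\<not> u ^ p \<preceq> a ^ q * u ^ p'" using le_height[OF cutI[OF q(1)], of p a p'] r(1) rr by auto
    then have "a ^ q * u ^ p' \<preceq> u ^ p" using total by blast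
    then have 1: "(a ^ q * u ^ p') * b ^ q \<preceq> u ^ p * b ^ q" by (rule mult_right)
    have "u ^ p' * 1 ^ q \<preceq> u ^ p' * (a * b) ^ q" by (intro mult_mono power_mono refl assms)
    then have "u ^ p' \<preceq> b ^ q * u ^ p" using trans[OF _ 1] by (simp add: power_mult_distrib mult.commute mult.left_commute)
    then have "(real p' - real p) / real q \<le> height b" using le_height[OF cutI[OF q(1)]] by simp
    moreover have "(real p' - real p) / real q = - r" unfolding rr by (simp only: minus_divide_left minus_diff_eq)
    ultimately have "- r \<le> height b" by simp
    then show False using r by simp
  qed
qed

text \<open>Subadditivity comes from superadditivity for \<open>a * b\<close> and an inverse of
  \<open>b\<close>.\<close>

lemma height_mult: "height (a * b) = height a + height b"
proof -
  obtain c where c: "b * c \<preceq> 1" "1 \<preceq> b * c" using inverse by blast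
  have "height (a * b) + height c \<le> height (a * (b * c))" using height_superadditive[of "a * b" c] by (simp add: mult.assoc)
  also have "\<dots> \<le> height (a * 1)" by (intro height_mono mult_mono refl c)
  finally have "height (a * b) \<le> height a + height b" using height_inverse[OF c] by simp
  then show ?thesis using height_superadditive by (simp add: order_antisym)
qed

text \<open>If \<open>a\<close> is not below \<open>b\<close>, then \<open>a\<close> times an
  inverse of \<open>b\<close> exceeds 1, so by the archimedean axiom its \<open>k\<close>-th power
  reaches \<open>u\<close> for some \<open>k\<close>; its height is then at least
  \<open>1 / k\<close>, hence positive.\<close>

lemma le_iff_height: "a \<preceq> b \<longleftrightarrow> height a \<le> height b"
proof
  assume "height a \<le> height b"
  show "a \<preceq> b"
  proof (rule ccontr)
    assume n: "\<not> a \<preceq> b"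
    obtain c where c: "b * c \<preceq> 1" "1 \<preceq> b * c" using inverse by blast
    have "\<not> a * c \<preceq> 1" using n trans[OF _ c(2)] mult_cancel by blast
    then obtain k where "\<not> (a * c) ^ k \<preceq> u" using archimedean total by blast
    then have k: "u \<preceq> (a * c) ^ k" "k \<noteq> 0" using total unit_ge by (blast, metis power_0)
    then have "u ^ 1 \<preceq> (a * c) ^ k * u ^ 0" by simp
    from le_height[OF cutI[OF _ this]] k(2) have "1 / real k \<le> height (a * c)" by simp
    moreover have "0 < 1 / real k" using k(2) by simp
    ultimately show False using \<open>height a \<le> height b\<close> height_inverse[OF c] by (simp add: height_mult)
  qed
qed (rule height_mono)

end

lemma (in archimedean_preordered_group) ex_real_embedding:
  "\<exists>v :: 'a \<Rightarrow> real. (\<forall>a b. v (a * b) = v a + v b) \<and> (\<forall>a b. a \<preceq> b \<longleftrightarrow> v a \<le> v b)"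
proof (cases "\<exists>u. \<not> u \<preceq> 1")
  case True
  then obtain u where "\<not> u \<preceq> 1" by blast
  then interpret archimedean_preordered_group_unit le u by unfold_locales
  show ?thesis using height_mult le_iff_height by blast
next
  \<comment> \<open>Nothing exceeds 1, so all elements are equivalent and the zero map is an
    embedding.\<close>
  case False
  have "1 \<preceq> b" for b
  proof -
    obtain c where "1 \<preceq> b * c" using inverse by blast
    moreover have "b * c \<preceq> b * 1" using False by (intro mult_mono refl) auto
    ultimately show ?thesis using trans by simp
  qed
  then have "a \<preceq> b" for a b using False trans by blast
  then show ?thesis by (intro exI[of _ "\<lambda>_. 0"]) simp
qed

section \<open>The real valuation and tropical rational functions\<close>

text \<open>The interface to \<open>F\<close> for all that follows the construction of
  \<open>v\<close>. The last axiom supplies tangible coefficients, which denominators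
  require.\<close>

locale nu_valuation =
  fixes F :: "('a::{comm_semiring, comm_monoid_mult}, 'z) nu_structure_scheme" and v :: "'a \<Rightarrow> real"
  assumes v_mult: "v (a * b) = v a + v b"
    and v_add: "v (a + b) = max (v a) (v b)"
    and v_star: "v (star F a) = - v a"
    and cong_iff: "nu_cong F a b \<longleftrightarrow> v a = v b"
    and le_iff: "nu_le F a b \<longleftrightarrow> v a \<le> v b"
    and ex_tangible: "\<exists>t\<in>tangible F. v t = v a"

section \<open>Construction of the valuation\<close>

lemma nu_domain_conjuncts:
  assumes "nu_domain F"
  shows "\<forall>a\<in>tangible F. \<forall>b\<in>tangible F. \<forall>c\<in>tangible F. a * b = a * c \<longrightarrow> b = c"
    and "transp_on (ghost F) (ghost_le F)"
    and "antisymp_on (ghost F) (ghost_le F)"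
    and "\<forall>g\<in>ghost F. \<forall>h\<in>ghost F. ghost_le F g h \<longleftrightarrow> g + h = h"
    and "range (nu F) \<subseteq> ghost F"
    and "\<forall>a. nu F (nu F a) = nu F a"
    and "\<forall>a b. nu F (a + b) = nu F a + nu F b"
    and "\<forall>a b. nu F (a * b) = nu F a * nu F b"
    and "nu F ` tangible F = ghost F"
    and "reflp_on (ghost F) (ghost_le F)"
  using assms unfolding nu_domain_def by - (elim conjE, assumption)+

text \<open>For an element that is not tangible, \<open>star\<close> is the ghost of the inverse of
  a tangible element with the same ghost; as \<open>\<nu>\<close> is multiplicative, both cases
  reduce to the tangible one.\<close>

lemma nu_mult_star:
  assumes "nu_semifield F"
  shows "nu F (a * star F a) = nu F 1"
proof -
  have "nu_domain F" and unit: "\<And>t. t \<in> tangible F \<Longrightarrow> \<exists>b\<in>tangible F. t * b = 1"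
    using assms unfolding nu_semifield_def by auto
  note dom = nu_domain_conjuncts[OF this(1)]
  have inv: "tangible_inverse F t \<in> tangible F \<and> t * tangible_inverse F t = 1" if t: "t \<in> tangible F" for t
  proof -
    obtain b where "b \<in> tangible F" "t * b = 1" using unit[OF t] by blast
    then have "\<exists>!b. b \<in> tangible F \<and> t * b = 1" using dom(1) t by (metis (no_types))
    then show ?thesis unfolding tangible_inverse_def by (rule theI')
  qed
  show ?thesis
  proof (cases "a \<in> tangible F")
    case True
    then show ?thesis using inv by (simp add: star_def)
  next
    case False
    define t where "t = (SOME t. t \<in> tangible F \<and> nu F t = nu F a)"
    have nu_mult: "nu F (x * y) = nu F x * nu F y" for x y using dom(8) by blast
    have "nu F a \<in> nu F ` tangible F" using dom(5,9) by auto
    then have "\<exists>t. t \<in> tangible F \<and> nu F t = nu F a" by (metis imageE)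
    from someI_ex[OF this] have t: "t \<in> tangible F" "nu F t = nu F a" unfolding t_def by simp_all
    have "star F a = nu F (tangible_inverse F t)" using False by (simp add: star_def t_def)
    then have "nu F (a * star F a) = nu F a * nu F (tangible_inverse F t)"
      using dom(6) by (simp add: nu_mult)
    also have "\<dots> = nu F (t * tangible_inverse F t)" using t nu_mult by simp
    finally show ?thesis using inv[OF t(1)] by simp
  qed
qed

text \<open>Bipotency makes the \<open>\<nu>\<close>-order total and distributivity makes it
  compatible with products, so Hoelder's embedding applies to the multiplicative monoid of
  \<open>F\<close>.\<close>

lemma ex_valuation:
  fixes F :: "('a::{comm_semiring, comm_monoid_mult}, 'z) nu_structure_scheme"
  assumes "nu_semifield F" and "nu_bipotent F" and "nu_archimedean F"
  shows "\<exists>v. nu_valuation F v"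
proof -
  have "nu_domain F" using assms(1) by (simp add: nu_semifield_def)
  note dom = nu_domain_conjuncts[OF this]
  have nu_mult: "nu F (x * y) = nu F x * nu F y" and nu_add: "nu F (x + y) = nu F x + nu F y"
    and nu_idem: "nu F (nu F x) = nu F x" and ghost: "nu F x \<in> ghost F" for x y
    using dom(5-8) by auto
  have le: "nu_le F a b \<longleftrightarrow> nu F (a + b) = nu F b" for a b
    using dom(4) ghost by (simp add: nu_le_def nu_add)
  have cong: "nu_cong F a b \<longleftrightarrow> nu_le F a b \<and> nu_le F b a" for a b
    using antisymp_onD[OF dom(3) ghost ghost] reflp_onD[OF dom(10) ghost] unfolding nu_le_def nu_cong_def
    by metis
  have sum_cases: "nu F (a + b) = nu F a \<or> nu F (a + b) = nu F b" for a b
    using assms(2) nu_idem unfolding nu_bipotent_def by (metis insertE singletonD)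
  have star: "nu F (a * star F a) = nu F 1" for a by (rule nu_mult_star[OF assms(1)])
  have cong_le: "nu F a = nu F b \<Longrightarrow> nu_le F a b" for a b using cong unfolding nu_cong_def by blast
  have trans: "nu_le F a b \<Longrightarrow> nu_le F b c \<Longrightarrow> nu_le F a c" for a b c
    using transp_onD[OF dom(2) ghost ghost ghost] unfolding nu_le_def by blast
  have mono: "nu_le F a b \<Longrightarrow> nu_le F (a * c) (b * c)" for a b c
    unfolding le by (metis nu_mult distrib_right)
  interpret archimedean_preordered_group "nu_le F"
  proof
    fix a b :: 'a
    show "nu_le F a b \<or> nu_le F b a" using sum_cases[of a b] unfolding le by (metis add.commute)
    show "\<exists>b. nu_le F (a * b) 1 \<and> nu_le F 1 (a * b)" using star[of a] cong_le by metis
    assume a: "nu_le F 1 a" and b: "\<And>n::nat. nu_le F (a ^ n) b"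
    \<comment> \<open>\<open>nu_archimedean\<close> asks for a bound on all integer powers. The
      powers of \<open>star F a\<close> stay below 1, and 1, being \<open>a ^ 0\<close>, is below
      \<open>b\<close>.\<close>
    have "nu_le F (star F a) 1"
    proof -
      have "nu_le F (star F a) (a * star F a)" using mono[OF a, of "star F a"] by simp
      then show ?thesis using cong_le[OF star] trans by blast
    qed
    then have "nu_le F (star F a ^ n) 1" for n
    proof (induction n)
      case (Suc n)
      then have "nu_le F (star F a ^ n * star F a) (star F a)" using mono[of _ 1 "star F a"] by simp
      then have "nu_le F (star F a ^ Suc n) (star F a)" by (simp add: mult.commute)
      then show ?case using \<open>nu_le F (star F a) 1\<close> by (rule trans)
    qed (simp add: cong_le)
    then have "nu_le F (star F a ^ n) b" for n using trans b[of 0] by (metis power_0)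
    then have "nu_le F (zpow F a k) b" for k using b by (simp add: zpow_def)
    then show "nu_le F a 1" using assms(3) cong unfolding nu_archimedean_def by blast
  qed (use trans mono in blast)+
  obtain v :: "'a \<Rightarrow> real" where v: "\<And>a b. v (a * b) = v a + v b" "\<And>a b. nu_le F a b \<longleftrightarrow> v a \<le> v b"
    using ex_real_embedding by blast
  have congv: "nu_cong F a b \<longleftrightarrow> v a = v b" for a b unfolding cong v by auto
  have "nu_valuation F v"
  proof
    fix a b :: 'a
    show "v (a + b) = max (v a) (v b)"
    proof (cases "nu_le F a b")
      case True
      then have "nu_cong F (a + b) b" by (simp add: le nu_cong_def)
      then show ?thesis using True congv v by simp
    next
      case False
      then have *: "nu_le F b a" using total by blast
      then have "nu_cong F (a + b) a" by (simp add: le nu_cong_def add.commute)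
      then show ?thesis using * congv v by simp
    qed
    have "v 1 = 0" using v(1)[of 1 1] by simp
    moreover have "v (a * star F a) = v 1" using star[of a] congv unfolding nu_cong_def by blast
    ultimately show "v (star F a) = - v a" using v by simp
    have "nu F a \<in> nu F ` tangible F" using dom(9) ghost by simp
    then show "\<exists>t\<in>tangible F. v t = v a" using congv unfolding nu_cong_def by (metis imageE)
  qed (use v congv in auto)
  then show ?thesis by blast
qed

section \<open>Tropical polynomials\<close>

context nu_valuation
begin

lemma v_one [simp]: "v 1 = 0"
  using v_mult[of 1 1] by simp

lemma v_power: "v (a ^ k) = real k * v a"
  by (induction k) (simp_all add: v_mult algebra_simps)

lemma v_zpow: "v (zpow F a k) = of_int k * v a"
  by (simp add: zpow_def v_power v_star)

lemma v_prod: "v (\<Prod>i\<in>I. g i) = (\<Sum>i\<in>I. v (g i))" if "finite I"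
  using that by induction (simp_all add: v_mult)

lemma v_abs: "v (nu_abs F a) = \<bar>v a\<bar>"
  by (simp add: nu_abs_def v_add v_star abs_real_def max_def)

lemma less_iff: "nu_less F a b \<longleftrightarrow> v a < v b"
  by (auto simp: nu_less_def le_iff cong_iff)

lemma fun_cong_iff: "fun_cong F g h \<longleftrightarrow> (\<forall>x. v (g x) = v (h x))"
  by (simp add: fun_cong_def cong_iff)

lemma v_ne_sum: "xs \<noteq> [] \<Longrightarrow> v (ne_sum xs) = Max (v ` set xs)"
  by (induction xs rule: ne_sum.induct) (simp_all add: v_add)

definition trop_mono :: "'a \<Rightarrow> ('n::finite \<Rightarrow> nat) \<Rightarrow> ('n \<Rightarrow> 'a) \<Rightarrow> real" where
  "trop_mono c e x = v c + (\<Sum>i\<in>UNIV. real (e i) * v (x i))"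

lemma v_monomial: "v (c * (\<Prod>i\<in>UNIV. x i ^ e i)) = trop_mono c e x"
  by (simp add: trop_mono_def v_mult v_prod v_power)

text \<open>The coefficients are elements of \<open>F\<close> and not reals, which keeps their
  values in the value group. Since \<open>c\<close> depends on the exponent, each exponent vector
  occurs only once, as in \<open>polynomial_funs\<close>.\<close>

definition trop_poly :: "(('n::finite \<Rightarrow> 'a) \<Rightarrow> real) set" where
  "trop_poly = {\<phi>. \<exists>E c. finite E \<and> E \<noteq> {} \<and> \<phi> = (\<lambda>x. Max ((\<lambda>e. trop_mono (c e) e x) ` E))}"

lemma polynomial_fun_trop_poly:
  assumes "p \<in> polynomial_funs C"
  shows "(\<lambda>x. v (p x)) \<in> trop_poly"
proof -
  obtain ms where ms: "ms \<noteq> []" "distinct (map snd ms)"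
    "p = (\<lambda>x. ne_sum (map (\<lambda>(c, e). c * (\<Prod>i\<in>UNIV. x i ^ e i)) ms))"
    using assms unfolding polynomial_funs_def by blast
  \<comment> \<open>Looks up the coefficient belonging to an exponent; the exponents in
    \<open>ms\<close> are distinct.\<close>
  define c where "c e = fst (the_elem {m \<in> set ms. snd m = e})" for e
  have c: "c (snd m) = fst m" if "m \<in> set ms" for m
  proof -
    have "{m' \<in> set ms. snd m' = snd m} = {m}" using ms(2) that by (auto simp: distinct_map inj_on_def)
    then show ?thesis by (simp add: c_def)
  qed
  have "v (p x) = Max ((\<lambda>e. trop_mono (c e) e x) ` snd ` set ms)" for x
  proof -
    have "v (p x) = Max ((\<lambda>m. trop_mono (fst m) (snd m) x) ` set ms)"
      unfolding ms(3) using ms(1) by (simp add: v_ne_sum image_image case_prod_beta v_monomial)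
    also have "(\<lambda>m. trop_mono (fst m) (snd m) x) ` set ms = (\<lambda>m. trop_mono (c (snd m)) (snd m) x) ` set ms"
      using c by (intro image_cong) auto
    finally show ?thesis by (simp add: image_image)
  qed
  then show ?thesis unfolding trop_poly_def using ms(1) by (auto intro!: exI[of _ "snd ` set ms"] exI[of _ c])
qed

text \<open>Each coefficient is replaced by a tangible one of the same value, so that tropical
  polynomials can serve both as numerators and as denominators.\<close>

lemma trop_poly_polynomial_fun:
  assumes "\<phi> \<in> trop_poly"
  shows "\<exists>p\<in>polynomial_funs (tangible F). \<forall>x. v (p x) = \<phi> x"
proof -
  obtain E c where E: "finite E" "E \<noteq> {}" "\<phi> = (\<lambda>x. Max ((\<lambda>e. trop_mono (c e) e x) ` E))"
    using assms unfolding trop_poly_def by blast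
  obtain t where t: "\<And>a. t a \<in> tangible F" "\<And>a. v (t a) = v a" using ex_tangible by metis
  obtain es where es: "set es = E" "distinct es" using finite_distinct_list[OF E(1)] by blast
  define ms where "ms = map (\<lambda>e. (t (c e), e)) es"
  define p where "p = (\<lambda>x. ne_sum (map (\<lambda>(c, e). c * (\<Prod>i\<in>UNIV. x i ^ e i)) ms))"
  have "ms \<noteq> []" using E(2) es(1) by (auto simp: ms_def)
  moreover have "distinct (map snd ms)" using es by (simp add: ms_def comp_def)
  moreover have "fst ` set ms \<subseteq> tangible F" using t by (auto simp: ms_def)
  ultimately have "p \<in> polynomial_funs (tangible F)" unfolding polynomial_funs_def p_def by blast
  moreover have "v (p x) = \<phi> x" for x
    unfolding p_def E(3) using \<open>ms \<noteq> []\<close>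
    by (simp add: v_ne_sum image_image case_prod_beta v_monomial ms_def es(1)) (simp add: trop_mono_def t)
  ultimately show ?thesis by blast
qed

lemma trop_polyI:
  assumes "finite E" "E \<noteq> {}" "\<And>x. \<phi> x = Max ((\<lambda>e. trop_mono (c e) e x) ` E)"
  shows "\<phi> \<in> trop_poly"
  unfolding trop_poly_def using assms by blast

lemma trop_poly_mono: "trop_mono c e \<in> trop_poly"
  by (rule trop_polyI[of "{e}" _ "\<lambda>_. c"]) simp_all

lemma trop_poly_max:
  assumes "\<phi> \<in> trop_poly" "\<psi> \<in> trop_poly"
  shows "(\<lambda>x. max (\<phi> x) (\<psi> x)) \<in> trop_poly"
proof -
  obtain E c where E: "finite E" "E \<noteq> {}" "\<phi> = (\<lambda>x. Max ((\<lambda>e. trop_mono (c e) e x) ` E))"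
    using assms unfolding trop_poly_def by blast
  obtain D d where D: "finite D" "D \<noteq> {}" "\<psi> = (\<lambda>x. Max ((\<lambda>e. trop_mono (d e) e x) ` D))"
    using assms unfolding trop_poly_def by blast
  \<comment> \<open>At a common exponent the coefficients are added, which amounts to the larger
    value.\<close>
  define b where "b e = (if e \<notin> D then c e else if e \<notin> E then d e else c e + d e)" for e
  have "max (\<phi> x) (\<psi> x) = Max ((\<lambda>e. trop_mono (b e) e x) ` (E \<union> D))" for x
  proof (rule antisym)
    have b: "trop_mono (c e) e x \<le> trop_mono (b e) e x" if "e \<in> E" for e
      using that by (auto simp: b_def trop_mono_def v_add)
    have d: "trop_mono (d e) e x \<le> trop_mono (b e) e x" if "e \<in> D" for e
      using that by (auto simp: b_def trop_mono_def v_add)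
    have M: "trop_mono (b e) e x \<le> Max ((\<lambda>e. trop_mono (b e) e x) ` (E \<union> D))" if "e \<in> E \<union> D" for e
      using E(1) D(1) that by (intro Max_ge) auto
    have "\<phi> x \<le> Max ((\<lambda>e. trop_mono (b e) e x) ` (E \<union> D))"
      unfolding E(3) by (rule Max.boundedI) (use E(1,2) order_trans[OF b M] in auto)
    moreover have "\<psi> x \<le> Max ((\<lambda>e. trop_mono (b e) e x) ` (E \<union> D))"
      unfolding D(3) by (rule Max.boundedI) (use D(1,2) order_trans[OF d M] in auto)
    ultimately show "max (\<phi> x) (\<psi> x) \<le> Max ((\<lambda>e. trop_mono (b e) e x) ` (E \<union> D))" by simp
  next
    have 1: "trop_mono (c e) e x \<le> \<phi> x" if "e \<in> E" for e unfolding E(3) using E(1) that by simp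
    have 2: "trop_mono (d e) e x \<le> \<psi> x" if "e \<in> D" for e unfolding D(3) using D(1) that by simp
    have "trop_mono (b e) e x \<le> max (\<phi> x) (\<psi> x)" if "e \<in> E \<union> D" for e
      using that 1[of e] 2[of e] by (auto simp: b_def trop_mono_def v_add)
    then show "Max ((\<lambda>e. trop_mono (b e) e x) ` (E \<union> D)) \<le> max (\<phi> x) (\<psi> x)"
      using E D by (subst Max_le_iff) auto
  qed
  then show ?thesis using E D by (intro trop_polyI[of "E \<union> D" _ b]) auto
qed

lemma trop_poly_Max:
  assumes "finite I" "I \<noteq> {}" "\<And>i. i \<in> I \<Longrightarrow> \<phi> i \<in> trop_poly"
  shows "(\<lambda>x. Max ((\<lambda>i. \<phi> i x) ` I)) \<in> trop_poly"
  using assms by (induction I rule: finite_ne_induct) (simp_all add: trop_poly_max)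

text \<open>Adding a monomial shifts every monomial of \<open>\<psi>\<close>; the maximum over the
  monomials of \<open>\<phi>\<close> is then a case of \<open>trop_poly_Max\<close>, which takes
  care of coinciding exponent sums.\<close>

lemma trop_poly_add:
  assumes "\<phi> \<in> trop_poly" "\<psi> \<in> trop_poly"
  shows "(\<lambda>x. \<phi> x + \<psi> x) \<in> trop_poly"
proof -
  obtain E c where E: "finite E" "E \<noteq> {}" "\<phi> = (\<lambda>x. Max ((\<lambda>e. trop_mono (c e) e x) ` E))"
    using assms unfolding trop_poly_def by blast
  obtain D d where D: "finite D" "D \<noteq> {}" "\<psi> = (\<lambda>x. Max ((\<lambda>e. trop_mono (d e) e x) ` D))"
    using assms unfolding trop_poly_def by blast
  have "trop_mono (c e) e x + \<psi> x = Max ((\<lambda>e'. trop_mono (c e * d e') (\<lambda>i. e i + e' i) x) ` D)" for e x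
  proof -
    have "trop_mono (d e') e' x + trop_mono (c e) e x = trop_mono (c e * d e') (\<lambda>i. e i + e' i) x" for e'
      by (simp add: trop_mono_def v_mult sum.distrib[symmetric] algebra_simps)
    then show ?thesis unfolding D(3)
      using Max_add_commute[OF D(1,2), of "\<lambda>e'. trop_mono (d e') e' x" "trop_mono (c e) e x"] by (simp add: add.commute)
  qed
  then have "(\<lambda>x. trop_mono (c e) e x + \<psi> x) \<in> trop_poly" for e
    using trop_poly_Max[OF D(1,2), of "\<lambda>e'. trop_mono (c e * d e') (\<lambda>i. e i + e' i)"] by (simp add: trop_poly_mono)
  then have "(\<lambda>x. Max ((\<lambda>e. trop_mono (c e) e x + \<psi> x) ` E)) \<in> trop_poly" using E by (intro trop_poly_Max)
  moreover have "(\<lambda>x. \<phi> x + \<psi> x) = (\<lambda>x. Max ((\<lambda>e. trop_mono (c e) e x + \<psi> x) ` E))"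
    unfolding E(3) using E(1,2) by (simp add: Max_add_commute)
  ultimately show ?thesis by simp
qed

section \<open>Tropical rational functions\<close>

definition trop_rat :: "(('n::finite \<Rightarrow> 'a) \<Rightarrow> real) set" where
  "trop_rat = {\<phi>. \<exists>h\<in>rational_funs F. \<forall>x. v (h x) = \<phi> x}"

lemma trop_rat_iff: "\<phi> \<in> trop_rat \<longleftrightarrow> (\<exists>p\<in>trop_poly. \<exists>q\<in>trop_poly. \<phi> = (\<lambda>x. p x - q x))"
proof
  assume "\<phi> \<in> trop_rat"
  then obtain h g where hg: "h \<in> polynomial_funs UNIV" "g \<in> polynomial_funs (tangible F)"
    "\<phi> = (\<lambda>x. v (h x * star F (g x)))"
    unfolding trop_rat_def rational_funs_def by fastforce
  then show "\<exists>p\<in>trop_poly. \<exists>q\<in>trop_poly. \<phi> = (\<lambda>x. p x - q x)"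
    using polynomial_fun_trop_poly by (fastforce simp: v_mult v_star)
next
  assume "\<exists>p\<in>trop_poly. \<exists>q\<in>trop_poly. \<phi> = (\<lambda>x. p x - q x)"
  then obtain p q where "p \<in> trop_poly" "q \<in> trop_poly" and pq: "\<phi> = (\<lambda>x. p x - q x)" by blast
  from this(1,2)[THEN trop_poly_polynomial_fun]
  obtain h g where hg: "h \<in> polynomial_funs (tangible F)" "g \<in> polynomial_funs (tangible F)"
    "\<And>x. \<phi> x = v (h x) - v (g x)"
    unfolding pq by fastforce
  have "h \<in> polynomial_funs UNIV" using hg(1) unfolding polynomial_funs_def by blast
  then have "(\<lambda>x. h x * star F (g x)) \<in> rational_funs F" using hg(2) unfolding rational_funs_def by blast
  then show "\<phi> \<in> trop_rat" unfolding trop_rat_def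
    by (intro CollectI bexI[of _ "\<lambda>x. h x * star F (g x)"]) (simp_all add: v_mult v_star hg(3))
qed

lemma trop_ratI: "p \<in> trop_poly \<Longrightarrow> q \<in> trop_poly \<Longrightarrow> (\<And>x. \<phi> x = p x - q x) \<Longrightarrow> \<phi> \<in> trop_rat"
  unfolding trop_rat_iff by blast

lemma trop_rat_uminus: "\<phi> \<in> trop_rat \<Longrightarrow> (\<lambda>x. - \<phi> x) \<in> trop_rat"
  unfolding trop_rat_iff by fastforce

lemma trop_rat_add:
  assumes "\<phi> \<in> trop_rat" "\<psi> \<in> trop_rat"
  shows "(\<lambda>x. \<phi> x + \<psi> x) \<in> trop_rat"
proof -
  obtain p q p' q' where *: "p \<in> trop_poly" "q \<in> trop_poly" "p' \<in> trop_poly" "q' \<in> trop_poly"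
    "\<phi> = (\<lambda>x. p x - q x)" "\<psi> = (\<lambda>x. p' x - q' x)"
    using assms unfolding trop_rat_iff by blast
  then show ?thesis
    by (intro trop_ratI[OF trop_poly_add[of p p'] trop_poly_add[of q q']]) simp_all
qed

text \<open>Common denominator:
  \<open>max (p - q) (p' - q') = max (p + q') (p' + q) - (q + q')\<close>.\<close>

lemma trop_rat_max:
  assumes "\<phi> \<in> trop_rat" "\<psi> \<in> trop_rat"
  shows "(\<lambda>x. max (\<phi> x) (\<psi> x)) \<in> trop_rat"
proof -
  obtain p q p' q' where *: "p \<in> trop_poly" "q \<in> trop_poly" "p' \<in> trop_poly" "q' \<in> trop_poly"
    "\<phi> = (\<lambda>x. p x - q x)" "\<psi> = (\<lambda>x. p' x - q' x)"
    using assms unfolding trop_rat_iff by blast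
  then show ?thesis
    by (intro trop_ratI[OF trop_poly_max[OF trop_poly_add[of p q'] trop_poly_add[of p' q]] trop_poly_add[of q q']])
      (simp_all add: max_def)
qed

lemma trop_rat_diff: "\<phi> \<in> trop_rat \<Longrightarrow> \<psi> \<in> trop_rat \<Longrightarrow> (\<lambda>x. \<phi> x - \<psi> x) \<in> trop_rat"
  using trop_rat_add[OF _ trop_rat_uminus] by simp

lemma trop_rat_mono_diff: "(\<lambda>x. trop_mono c e x - trop_mono d e' x) \<in> trop_rat"
  by (rule trop_ratI[OF trop_poly_mono trop_poly_mono]) simp

lemma trop_rat_const: "(\<lambda>x. v c) \<in> trop_rat"
  using trop_rat_mono_diff[of c "\<lambda>_. 0" 1 "\<lambda>_. 0"] by (simp add: trop_mono_def)

lemma trop_rat_zero: "(\<lambda>x. 0) \<in> trop_rat"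
  using trop_rat_const[of 1] by simp

lemma trop_rat_abs:
  assumes "\<phi> \<in> trop_rat"
  shows "(\<lambda>x. \<bar>\<phi> x\<bar>) \<in> trop_rat"
proof -
  have "(\<lambda>x. \<bar>\<phi> x\<bar>) = (\<lambda>x. max (\<phi> x) (- \<phi> x))" by auto
  then show ?thesis using trop_rat_max[OF assms trop_rat_uminus[OF assms]] by simp
qed

lemma trop_rat_scale: "\<phi> \<in> trop_rat \<Longrightarrow> (\<lambda>x. real k * \<phi> x) \<in> trop_rat"
  by (induction k) (simp_all add: trop_rat_zero trop_rat_add algebra_simps)

lemma rational_trop_rat: "h \<in> rational_funs F \<Longrightarrow> (\<lambda>x. v (h x)) \<in> trop_rat"
  unfolding trop_rat_def by blast

section \<open>Kernels as convex sets\<close>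

lemma nu_mem_iff: "nu_mem F g K \<longleftrightarrow> (\<forall>h\<in>rational_funs F. (\<forall>x. v (h x) = v (g x)) \<longrightarrow> h \<in> K)"
  by (simp add: nu_mem_def fun_cong_iff)

text \<open>If \<open>max \<alpha> \<beta> = 0\<close> in values, then at each point the combination
  is at least one of \<open>a\<close>, \<open>b\<close> and at most their maximum, so
  \<open>d + d'\<close> bounds it. Multiples of one function give principal kernels, constants give
  the bounded functions.\<close>

lemma nu_kernel_dominated:
  fixes D :: "(('n::finite \<Rightarrow> 'a) \<Rightarrow> real) set"
  assumes "D \<noteq> {}" and nonneg: "\<And>d x. d \<in> D \<Longrightarrow> (0::real) \<le> d x"
    and add: "\<And>d d'. d \<in> D \<Longrightarrow> d' \<in> D \<Longrightarrow> (\<lambda>x. d x + d' x) \<in> D"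
  shows "nu_kernel F {h \<in> rational_funs F. \<exists>d\<in>D. \<forall>x. \<bar>v (h x)\<bar> \<le> d x}" (is "nu_kernel F ?K")
  unfolding nu_kernel_def
proof (intro conjI ballI impI)
  obtain d where d: "d \<in> D" using assms(1) by blast
  have "(\<lambda>x :: 'n \<Rightarrow> 'a. 0) \<in> trop_rat" by (rule trop_rat_zero)
  then obtain h :: "('n \<Rightarrow> 'a) \<Rightarrow> 'a" where h: "h \<in> rational_funs F" "\<And>x. v (h x) = 0"
    unfolding trop_rat_def by blast
  then have "h \<in> ?K" using d nonneg by (auto intro!: bexI[of _ d])
  then show "?K \<noteq> {}" by blast
next
  fix a b assume "a \<in> ?K" "b \<in> ?K"
  then obtain d d' where d: "d \<in> D" "\<And>x. \<bar>v (a x)\<bar> \<le> d x" "d' \<in> D" "\<And>x. \<bar>v (b x)\<bar> \<le> d' x" by blast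
  have mem: "nu_mem F g ?K" if "\<And>x. \<bar>v (g x)\<bar> \<le> d x + d' x" for g
    unfolding nu_mem_iff using that add[OF d(1,3)] by (auto intro!: bexI[of _ "\<lambda>x. d x + d' x"])
  have "\<bar>v (a x * b x)\<bar> \<le> d x + d' x" for x using d(2)[of x] d(4)[of x] by (simp add: v_mult)
  then show "nu_mem F (\<lambda>x. a x * b x) ?K" by (rule mem)
  fix \<alpha> \<beta> :: "('n \<Rightarrow> 'a) \<Rightarrow> 'a" assume "fun_cong F (\<lambda>x. \<alpha> x + \<beta> x) (\<lambda>x. 1)"
  then have "max (v (\<alpha> x)) (v (\<beta> x)) = 0" for x by (simp add: fun_cong_iff v_add)
  then have "\<bar>v (\<alpha> x * a x + \<beta> x * b x)\<bar> \<le> d x + d' x" for x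
    using d(2)[of x] d(4)[of x] by (simp add: v_add v_mult max_def abs_le_iff split: if_splits) (smt (verit))
  then show "nu_mem F (\<lambda>x. \<alpha> x * a x + \<beta> x * b x) ?K" by (rule mem)
qed (auto simp: nu_mem_iff v_star)

text \<open>The convex subgroup generated by \<open>\<phi>\<close>, restricted to rational
  functions.\<close>

definition conv :: "(('n::finite \<Rightarrow> 'a) \<Rightarrow> real) \<Rightarrow> (('n \<Rightarrow> 'a) \<Rightarrow> 'a) set" where
  "conv \<phi> = {h \<in> rational_funs F. \<exists>k::nat. \<forall>x. \<bar>v (h x)\<bar> \<le> real k * \<bar>\<phi> x\<bar>}"

lemma convI: "h \<in> rational_funs F \<Longrightarrow> (\<And>x. \<bar>v (h x)\<bar> \<le> real k * \<bar>\<phi> x\<bar>) \<Longrightarrow> h \<in> conv \<phi>"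
  unfolding conv_def by blast

lemma convE:
  assumes "h \<in> conv \<phi>"
  obtains k :: nat where "h \<in> rational_funs F" "\<And>x. \<bar>v (h x)\<bar> \<le> real k * \<bar>\<phi> x\<bar>"
  using assms unfolding conv_def by blast

lemma conv_cong: "(\<And>x. \<bar>\<phi> x\<bar> = \<bar>\<psi> x\<bar>) \<Longrightarrow> conv \<phi> = conv \<psi>"
  by (simp add: conv_def)

lemma nu_kernel_conv: "nu_kernel F (conv \<phi>)"
proof -
  have "conv \<phi> = {h \<in> rational_funs F. \<exists>d\<in>range (\<lambda>(k::nat) x. real k * \<bar>\<phi> x\<bar>). \<forall>x. \<bar>v (h x)\<bar> \<le> d x}"
    by (auto simp: conv_def)
  moreover have "nu_kernel F \<dots>"
    by (rule nu_kernel_dominated) (auto simp: image_iff simp flip: distrib_right of_nat_add)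
  ultimately show ?thesis by simp
qed

text \<open>The bounded rational functions form a kernel that contains the constants.\<close>

lemma const_kernel_bounded:
  assumes "h \<in> const_kernel F"
  shows "h \<in> rational_funs F" "\<exists>C. \<forall>x. \<bar>v (h x)\<bar> \<le> C"
proof -
  let ?D = "(\<lambda>C x. C) ` {0..} :: (('n::finite \<Rightarrow> 'a) \<Rightarrow> real) set"
  let ?K = "{h \<in> rational_funs F. \<exists>d\<in>?D. \<forall>x. \<bar>v (h x)\<bar> \<le> d x}"
  have "nu_kernel F ?K" by (rule nu_kernel_dominated) (auto simp: image_iff)
  moreover have "nu_mem F (\<lambda>x. c) ?K" for c unfolding nu_mem_iff by (auto intro!: bexI[of _ "\<bar>v c\<bar>"])
  ultimately have "const_kernel F \<subseteq> ?K" unfolding const_kernel_def kernel_gen_def by blast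
  then show "h \<in> rational_funs F" "\<exists>C. \<forall>x. \<bar>v (h x)\<bar> \<le> C" using assms by blast+
qed

text \<open>Membership in \<open>K\<close> in terms of values. The first conjunct excludes the
  vacuous case in which no rational function has the values \<open>\<phi>\<close>.\<close>

definition kernel_mem :: "(('n::finite \<Rightarrow> 'a) \<Rightarrow> 'a) set \<Rightarrow> (('n \<Rightarrow> 'a) \<Rightarrow> real) \<Rightarrow> bool" where
  "kernel_mem K \<phi> \<longleftrightarrow> \<phi> \<in> trop_rat \<and> (\<forall>h\<in>rational_funs F. (\<forall>x. v (h x) = \<phi> x) \<longrightarrow> h \<in> K)"

lemma kernel_memE:
  assumes "kernel_mem K \<phi>"
  obtains h where "h \<in> rational_funs F" "h \<in> K" "\<And>x. v (h x) = \<phi> x"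
  using assms unfolding kernel_mem_def trop_rat_def by blast

lemma kernel_mem_add:
  assumes "nu_kernel F K" "kernel_mem K \<phi>" "kernel_mem K \<psi>"
  shows "kernel_mem K (\<lambda>x. \<phi> x + \<psi> x)"
proof -
  obtain a where a: "a \<in> K" "\<And>x. v (a x) = \<phi> x" using kernel_memE[OF assms(2)] by blast
  obtain b where b: "b \<in> K" "\<And>x. v (b x) = \<psi> x" using kernel_memE[OF assms(3)] by blast
  have "nu_mem F (\<lambda>x. a x * b x) K" using assms(1) a(1) b(1) unfolding nu_kernel_def by blast
  then show ?thesis using assms(2,3) a(2) b(2)
    by (simp add: trop_rat_add kernel_mem_def nu_mem_iff v_mult)
qed

lemma kernel_mem_uminus:
  assumes "nu_kernel F K" "kernel_mem K \<phi>"
  shows "kernel_mem K (\<lambda>x. - \<phi> x)"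
proof -
  obtain a where a: "a \<in> K" "\<And>x. v (a x) = \<phi> x" using kernel_memE[OF assms(2)] by blast
  have "nu_mem F (\<lambda>x. star F (a x)) K" using assms(1) a(1) unfolding nu_kernel_def by blast
  then show ?thesis using assms(2) a(2)
    by (simp add: trop_rat_uminus kernel_mem_def nu_mem_iff v_star)
qed

lemma kernel_mem_combine:
  assumes "nu_kernel F K" "kernel_mem K \<phi>" "kernel_mem K \<psi>" "\<alpha> \<in> trop_rat" "\<beta> \<in> trop_rat"
    and "\<And>x. max (\<alpha> x) (\<beta> x) = 0"
  shows "kernel_mem K (\<lambda>x. max (\<alpha> x + \<phi> x) (\<beta> x + \<psi> x))"
proof -
  obtain a where a: "a \<in> K" "\<And>x. v (a x) = \<phi> x" using kernel_memE[OF assms(2)] by blast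
  obtain b where b: "b \<in> K" "\<And>x. v (b x) = \<psi> x" using kernel_memE[OF assms(3)] by blast
  obtain r s where r: "r \<in> rational_funs F" "\<And>x. v (r x) = \<alpha> x" and s: "s \<in> rational_funs F" "\<And>x. v (s x) = \<beta> x"
    using assms(4,5) unfolding trop_rat_def by blast
  have "fun_cong F (\<lambda>x. r x + s x) (\<lambda>x. 1)" using assms(6) r s by (simp add: fun_cong_iff v_add)
  then have "nu_mem F (\<lambda>x. r x * a x + s x * b x) K"
    using assms(1) a(1) b(1) r(1) s(1) unfolding nu_kernel_def by blast
  moreover have "(\<lambda>x. max (\<alpha> x + \<phi> x) (\<beta> x + \<psi> x)) \<in> trop_rat"
    using assms(2-5) by (auto simp: kernel_mem_def intro: trop_rat_add trop_rat_max)
  ultimately show ?thesis using a(2) b(2) r(2) s(2)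
    by (simp add: kernel_mem_def nu_mem_iff v_mult v_add)
qed

text \<open>Starting from \<open>\<phi>\<close>, the kernel operations yield in turn
  \<open>\<bar>\<phi>\<bar>\<close>, its multiples, all rational functions between 0 and such a
  multiple, and finally \<open>h\<close> as the difference of its positive and negative
  parts.\<close>

lemma conv_subset_kernel:
  assumes K: "nu_kernel F K" and \<phi>: "kernel_mem K \<phi>"
  shows "conv \<phi> \<subseteq> K"
proof
  fix h assume "h \<in> conv \<phi>"
  then obtain k where h: "h \<in> rational_funs F" "\<And>x. \<bar>v (h x)\<bar> \<le> real k * \<bar>\<phi> x\<bar>" using convE by blast
  have zero: "kernel_mem K (\<lambda>x. 0)"
    using kernel_mem_add[OF K \<phi> kernel_mem_uminus[OF K \<phi>]] by simp
  have "(\<lambda>x. \<bar>\<phi> x\<bar>) = (\<lambda>x. max (0 + \<phi> x) (0 + - \<phi> x))" by auto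
  then have abs: "kernel_mem K (\<lambda>x. \<bar>\<phi> x\<bar>)"
    using kernel_mem_combine[OF K \<phi> kernel_mem_uminus[OF K \<phi>] trop_rat_zero trop_rat_zero] by simp
  have mult: "kernel_mem K (\<lambda>x. real k * \<bar>\<phi> x\<bar>)" for k
  proof (induction k)
    case (Suc k)
    then show ?case using kernel_mem_add[OF K abs Suc] by (simp add: distrib_right)
  qed (simp add: zero)
  have interval: "kernel_mem K \<psi>" if \<psi>: "\<psi> \<in> trop_rat" "\<And>x. 0 \<le> \<psi> x" "\<And>x. \<psi> x \<le> real k * \<bar>\<phi> x\<bar>" for \<psi>
  proof -
    \<comment> \<open>The coefficient \<open>\<psi> - k * \<bar>\<phi>\<bar>\<close> is at most 0,
      so together with the coefficient 0 it is admissible in the kernel axiom; it turns the multiple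
      of \<open>\<bar>\<phi>\<bar>\<close> into \<open>\<psi>\<close>.\<close>
    have "kernel_mem K (\<lambda>x. max (\<psi> x - real k * \<bar>\<phi> x\<bar> + real k * \<bar>\<phi> x\<bar>) (0 + 0))"
      using mult \<psi>(3) by (intro kernel_mem_combine[OF K mult zero] trop_rat_diff \<psi> trop_rat_zero)
        (auto simp: kernel_mem_def)
    then show ?thesis using \<psi>(2) by (simp add: max_absorb1)
  qed
  have hr: "(\<lambda>x. v (h x)) \<in> trop_rat" using h(1) by (rule rational_trop_rat)
  have "0 \<le> real k * \<bar>\<phi> x\<bar>" for x by simp
  then have "kernel_mem K (\<lambda>x. max (v (h x)) 0)" "kernel_mem K (\<lambda>x. max (- v (h x)) 0)"
    using h(2) hr by (auto intro!: interval trop_rat_max trop_rat_uminus trop_rat_zero simp: abs_le_iff)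
  from kernel_mem_add[OF K this(1) kernel_mem_uminus[OF K this(2)]]
  have "kernel_mem K (\<lambda>x. max (v (h x)) 0 + - max (- v (h x)) 0)" .
  moreover have "max r 0 + - max (- r) 0 = r" for r :: real by (simp add: max_def)
  ultimately have "kernel_mem K (\<lambda>x. v (h x))" by simp
  then show "h \<in> K" using h(1) by (simp add: kernel_mem_def)
qed

text \<open>It suffices that \<open>g\<close> agrees in value with a rational function; this covers
  L-monomials and \<open>1 + m\<close>, which are not given as quotients of polynomials.\<close>

lemma kernel_gen_conv:
  assumes "(\<lambda>x. v (g x)) \<in> trop_rat"
  shows "kernel_gen F {g} = conv (\<lambda>x. v (g x))"
proof
  have "nu_mem F g (conv (\<lambda>x. v (g x)))"
    unfolding nu_mem_iff by (auto intro!: convI[of _ 1])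
  then show "kernel_gen F {g} \<subseteq> conv (\<lambda>x. v (g x))"
    unfolding kernel_gen_def using nu_kernel_conv by blast
  show "conv (\<lambda>x. v (g x)) \<subseteq> kernel_gen F {g}"
    unfolding kernel_gen_def using assms
    by (auto simp: nu_mem_iff kernel_mem_def dest!: conv_subset_kernel[THEN subsetD, rotated 2])
qed

section \<open>Generators, products and intersections of principal kernels\<close>

lemma ex_generator:
  assumes "\<phi> \<in> trop_rat"
  obtains h where "h \<in> rational_funs F" "\<And>x. v (h x) = \<phi> x" "kernel_gen F {h} = conv \<phi>"
proof -
  obtain h where h: "h \<in> rational_funs F" "\<And>x. v (h x) = \<phi> x"
    using assms unfolding trop_rat_def by blast
  then show ?thesis using kernel_gen_conv[of h] assms that by simp
qed

lemma principal_conv: "\<phi> \<in> trop_rat \<Longrightarrow> principal_kernel F (conv \<phi>)"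
  unfolding principal_kernel_def by (metis ex_generator)

text \<open>The Riesz decomposition property, with the first summand obtained by truncation.\<close>

lemma kernel_mult_conv:
  assumes "\<phi> \<in> trop_rat" "\<psi> \<in> trop_rat"
  shows "kernel_mult F (conv \<phi>) (conv \<psi>) = conv (\<lambda>x. \<bar>\<phi> x\<bar> + \<bar>\<psi> x\<bar>)"
proof (intro set_eqI iffI)
  fix h assume "h \<in> kernel_mult F (conv \<phi>) (conv \<psi>)"
  then obtain a b where h: "h \<in> rational_funs F" "\<And>x. v (h x) = v (a x) + v (b x)"
    and "a \<in> conv \<phi>" "b \<in> conv \<psi>"
    unfolding kernel_mult_def by (auto simp: fun_cong_iff v_mult)
  then obtain k l where k: "\<And>x. \<bar>v (a x)\<bar> \<le> real k * \<bar>\<phi> x\<bar>" and l: "\<And>x. \<bar>v (b x)\<bar> \<le> real l * \<bar>\<psi> x\<bar>"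
    unfolding conv_def by blast
  have "\<bar>v (h x)\<bar> \<le> real (k + l) * \<bar>\<bar>\<phi> x\<bar> + \<bar>\<psi> x\<bar>\<bar>" for x
  proof -
    have "0 \<le> real l * \<bar>\<phi> x\<bar>" "0 \<le> real k * \<bar>\<psi> x\<bar>" by simp_all
    moreover have "real (k + l) * \<bar>\<bar>\<phi> x\<bar> + \<bar>\<psi> x\<bar>\<bar>
        = real k * \<bar>\<phi> x\<bar> + real k * \<bar>\<psi> x\<bar> + real l * \<bar>\<phi> x\<bar> + real l * \<bar>\<psi> x\<bar>"
      by (simp add: algebra_simps)
    ultimately show ?thesis using k[of x] l[of x] h(2)[of x] by linarith
  qed
  then show "h \<in> conv (\<lambda>x. \<bar>\<phi> x\<bar> + \<bar>\<psi> x\<bar>)" using h(1) by (rule convI[rotated])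
next
  fix h assume "h \<in> conv (\<lambda>x. \<bar>\<phi> x\<bar> + \<bar>\<psi> x\<bar>)"
  then obtain k where h: "h \<in> rational_funs F" "\<And>x. \<bar>v (h x)\<bar> \<le> real k * \<bar>\<bar>\<phi> x\<bar> + \<bar>\<psi> x\<bar>\<bar>" using convE by blast
  \<comment> \<open>The truncation of \<open>h\<close> to the interval from
    \<open>- k * \<bar>\<phi>\<bar>\<close> to \<open>k * \<bar>\<phi>\<bar>\<close>, with the
    minimum expressed by negation and maximum, under which \<open>trop_rat\<close> is
    closed.\<close>
  define \<alpha> where "\<alpha> x = max (- max (- v (h x)) (- (real k * \<bar>\<phi> x\<bar>))) (- (real k * \<bar>\<phi> x\<bar>))" for x
  have \<alpha>: "\<alpha> \<in> trop_rat" unfolding \<alpha>_def using h(1) assms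
    by (intro trop_rat_max trop_rat_uminus trop_rat_scale trop_rat_abs rational_trop_rat)
  then have "(\<lambda>x. v (h x) - \<alpha> x) \<in> trop_rat" using h(1) by (intro trop_rat_diff rational_trop_rat)
  then obtain b where b: "b \<in> rational_funs F" "\<And>x. v (b x) = v (h x) - \<alpha> x"
    unfolding trop_rat_def by blast
  obtain a where a: "a \<in> rational_funs F" "\<And>x. v (a x) = \<alpha> x"
    using \<alpha> unfolding trop_rat_def by blast
  have pos: "0 \<le> real k * \<bar>\<phi> x\<bar>" "0 \<le> real k * \<bar>\<psi> x\<bar>" for x by simp_all
  have *: "\<bar>v (h x)\<bar> \<le> real k * \<bar>\<phi> x\<bar> + real k * \<bar>\<psi> x\<bar>" for x using h(2)[of x] by (simp add: distrib_left)
  have "\<bar>\<alpha> x\<bar> \<le> real k * \<bar>\<phi> x\<bar>" for x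
    unfolding \<alpha>_def using pos[of x] by linarith
  then have "a \<in> conv \<phi>" using a by (intro convI) simp_all
  moreover have "\<bar>v (h x) - \<alpha> x\<bar> \<le> real k * \<bar>\<psi> x\<bar>" for x
    unfolding \<alpha>_def using *[of x] pos[of x] by linarith
  then have "b \<in> conv \<psi>" using b by (intro convI) simp_all
  moreover have "fun_cong F h (\<lambda>x. a x * b x)" using a(2) b(2) by (simp add: fun_cong_iff v_mult)
  ultimately show "h \<in> kernel_mult F (conv \<phi>) (conv \<psi>)"
    unfolding kernel_mult_def using h(1) by blast
qed

lemma trop_rat_sum_list:
  "(\<And>i. i \<in> set is \<Longrightarrow> \<phi> i \<in> trop_rat) \<Longrightarrow> (\<lambda>x. \<Sum>i\<leftarrow>is. \<phi> i x) \<in> trop_rat"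
  by (induction "is") (simp_all add: trop_rat_zero trop_rat_add)

lemma kernel_prod_conv:
  "(\<And>i. i \<in> set is \<Longrightarrow> \<phi> i \<in> trop_rat) \<Longrightarrow>
    kernel_prod F (map (\<lambda>i. conv (\<phi> i)) is) = conv (\<lambda>x. \<Sum>i\<leftarrow>is. \<bar>\<phi> i x\<bar>)"
proof (induction "is")
  case Nil
  then show ?case using kernel_gen_conv[of "\<lambda>x. 1"] by (simp add: kernel_prod_def trop_rat_zero)
next
  case (Cons i "is")
  have "kernel_prod F (map (\<lambda>i. conv (\<phi> i)) (i # is)) = kernel_mult F (conv (\<phi> i)) (conv (\<lambda>x. \<Sum>i\<leftarrow>is. \<bar>\<phi> i x\<bar>))"
    using Cons by (simp add: kernel_prod_def)
  also have "\<dots> = conv (\<lambda>x. \<bar>\<phi> i x\<bar> + \<bar>\<Sum>i\<leftarrow>is. \<bar>\<phi> i x\<bar>\<bar>)"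
    using Cons(2) by (intro kernel_mult_conv trop_rat_sum_list) (auto intro: trop_rat_abs)
  also have "\<dots> = conv (\<lambda>x. \<Sum>i\<leftarrow>i # is. \<bar>\<phi> i x\<bar>)"
  proof (rule conv_cong)
    fix x
    have "0 \<le> (\<Sum>i\<leftarrow>is. \<bar>\<phi> i x\<bar>)" by (rule sum_list_nonneg) auto
    then show "\<bar>\<bar>\<phi> i x\<bar> + \<bar>\<Sum>i\<leftarrow>is. \<bar>\<phi> i x\<bar>\<bar>\<bar> = \<bar>\<Sum>i\<leftarrow>i # is. \<bar>\<phi> i x\<bar>\<bar>" by simp
  qed
  finally show ?case .
qed

text \<open>The assumptions make \<open>\<bar>\<phi>\<bar>\<close> the pointwise minimum of the
  \<open>\<bar>\<psi> p\<bar>\<close>. The sum of the finitely many factors \<open>k p\<close> works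
  at every point, whichever \<open>p\<close> attains the minimum there.\<close>

lemma conv_Inter:
  assumes "finite P" "\<phi> \<in> trop_rat" "\<And>p x. p \<in> P \<Longrightarrow> \<bar>\<phi> x\<bar> \<le> \<bar>\<psi> p x\<bar>"
    and "\<And>x. \<exists>p\<in>P. \<bar>\<psi> p x\<bar> = \<bar>\<phi> x\<bar>"
  shows "conv \<phi> = (\<Inter>p\<in>P. conv (\<psi> p))"
proof (intro set_eqI iffI INT_I)
  fix h p assume "h \<in> conv \<phi>" "p \<in> P"
  then obtain k where h: "h \<in> rational_funs F" "\<And>x. \<bar>v (h x)\<bar> \<le> real k * \<bar>\<phi> x\<bar>" using convE by blast
  have "\<bar>v (h x)\<bar> \<le> real k * \<bar>\<psi> p x\<bar>" for x
    using h(2)[of x] mult_left_mono[OF assms(3)[OF \<open>p \<in> P\<close>, of x], of "real k"] by simp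
  then show "h \<in> conv (\<psi> p)" using h(1) by (rule convI[rotated])
next
  fix h assume h: "h \<in> (\<Inter>p\<in>P. conv (\<psi> p))"
  then have "\<forall>p\<in>P. \<exists>k::nat. \<forall>x. \<bar>v (h x)\<bar> \<le> real k * \<bar>\<psi> p x\<bar>" unfolding conv_def by blast
  then obtain k :: "_ \<Rightarrow> nat" where k: "\<And>p x. p \<in> P \<Longrightarrow> \<bar>v (h x)\<bar> \<le> real (k p) * \<bar>\<psi> p x\<bar>" by metis
  have "\<bar>v (h x)\<bar> \<le> real (\<Sum>p\<in>P. k p) * \<bar>\<phi> x\<bar>" for x
  proof -
    obtain p where p: "p \<in> P" "\<bar>\<psi> p x\<bar> = \<bar>\<phi> x\<bar>" using assms(4) by blast
    have "k p \<le> (\<Sum>p\<in>P. k p)" using assms(1) p(1) by (intro member_le_sum) auto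
    then have "real (k p) * \<bar>\<phi> x\<bar> \<le> real (\<Sum>p\<in>P. k p) * \<bar>\<phi> x\<bar>" by (intro mult_right_mono) (simp_all only: of_nat_le_iff abs_ge_zero)
    then show ?thesis using k[OF p(1), of x] p(2) by simp
  qed
  moreover have "h \<in> rational_funs F" using assms(4) h unfolding conv_def by blast
  ultimately show "h \<in> conv \<phi>" by (intro convI)
qed

section \<open>Regions\<close>

text \<open>Openness in the topology with the open intervals as basis.\<close>

definition nu_open :: "('n \<Rightarrow> 'a) set \<Rightarrow> bool" where
  "nu_open U \<longleftrightarrow> (\<forall>y\<in>U. \<exists>a b. y \<in> open_interval F a b \<and> open_interval F a b \<subseteq> U)"

lemma mem_open_interval: "x \<in> open_interval F a b \<longleftrightarrow> (\<forall>i. v (a i) < v (x i) \<and> v (x i) < v (b i))"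
  by (simp add: open_interval_def less_iff)

lemma nu_openD:
  assumes "nu_open U" "y \<in> U"
  obtains a b where "y \<in> open_interval F a b" "open_interval F a b \<subseteq> U"
  using assms unfolding nu_open_def by blast

lemma nu_open_Int:
  assumes "nu_open U" "nu_open V"
  shows "nu_open (U \<inter> V)"
  unfolding nu_open_def
proof
  fix y assume y: "y \<in> U \<inter> V"
  obtain a b where ab: "y \<in> open_interval F a b" "open_interval F a b \<subseteq> U" using y assms(1) by (auto elim: nu_openD)
  obtain c d where cd: "y \<in> open_interval F c d" "open_interval F c d \<subseteq> V" using y assms(2) by (auto elim: nu_openD)
  \<comment> \<open>Addition in \<open>F\<close> yields the larger of the lower bounds; the smaller
    of the upper bounds is chosen by cases.\<close>
  define l where "l i = a i + c i" for i
  define u where "u i = (if v (b i) \<le> v (d i) then b i else d i)" for i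
  have "open_interval F l u = open_interval F a b \<inter> open_interval F c d"
    by (auto simp: mem_open_interval l_def u_def v_add split: if_splits) (smt (verit))+
  then have "y \<in> open_interval F l u \<and> open_interval F l u \<subseteq> U \<inter> V" using ab cd by auto
  then show "\<exists>a b. y \<in> open_interval F a b \<and> open_interval F a b \<subseteq> U \<inter> V" by blast
qed

lemma nu_open_Union: "(\<And>U. U \<in> \<U> \<Longrightarrow> nu_open U) \<Longrightarrow> nu_open (\<Union>\<U>)"
  unfolding nu_open_def by (meson Union_iff Union_upper order_trans)

text \<open>Openness of the whole space accounts for the empty family; it fails for a trivial value
  group, where all open intervals are empty.\<close>

lemma nu_open_Inter:
  fixes \<U> :: "('n \<Rightarrow> 'a) set set"
  shows "finite \<U> \<Longrightarrow> nu_open (UNIV :: ('n \<Rightarrow> 'a) set) \<Longrightarrow> (\<And>U. U \<in> \<U> \<Longrightarrow> nu_open U) \<Longrightarrow> nu_open (\<Inter>\<U>)"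
  by (induction rule: finite_induct) (simp_all add: nu_open_Int)

text \<open>A finite Baire argument: if \<open>U\<close> is not contained in \<open>C p\<close>,
  then \<open>U\<close> minus \<open>C p\<close> is open, nonempty and covered by the remaining
  sets.\<close>

lemma finite_closed_cover:
  assumes "finite P" "\<And>p. p \<in> P \<Longrightarrow> nu_open (- C p)" "nu_open U" "U \<noteq> {}" "U \<subseteq> (\<Union>p\<in>P. C p)"
  shows "\<exists>p\<in>P. \<exists>a b. open_interval F a b \<noteq> {} \<and> open_interval F a b \<subseteq> U \<inter> C p"
  using assms
proof (induction arbitrary: U rule: finite_induct)
  case (insert p P)
  show ?case
  proof (cases "U \<subseteq> C p")
    case True
    then show ?thesis using insert.prems(2,3) nu_openD[of U] by (metis Int_absorb2 empty_iff equals0I insertI1)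
  next
    case False
    have "nu_open (U \<inter> - C p)" using insert.prems by (intro nu_open_Int) auto
    then have "\<exists>p'\<in>P. \<exists>a b. open_interval F a b \<noteq> {} \<and> open_interval F a b \<subseteq> (U \<inter> - C p) \<inter> C p'"
      using False insert.prems(4) by (intro insert.IH) (auto intro: insert.prems)
    then show ?thesis by blast
  qed
qed simp

text \<open>The sets that miss \<open>x\<close> are removed from the space; what is left is an open
  neighbourhood of \<open>x\<close>. A set with an interval inside this neighbourhood cannot be one
  of those removed, so it contains \<open>x\<close>, though the interval may not.\<close>

lemma local_closed_cover:
  fixes C :: "'p \<Rightarrow> ('n \<Rightarrow> 'a) set"
  assumes "finite P" "\<And>p. p \<in> P \<Longrightarrow> nu_open (- C p)" "nu_open (UNIV :: ('n \<Rightarrow> 'a) set)" "(\<Union>p\<in>P. C p) = UNIV"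
  shows "\<exists>p\<in>P. x \<in> C p \<and> (\<exists>a b. open_interval F a b \<noteq> {} \<and> open_interval F a b \<subseteq> C p)"
proof -
  let ?U = "\<Inter>p\<in>{p \<in> P. x \<notin> C p}. - C p"
  have U: "nu_open ?U" using assms(1-3) by (intro nu_open_Inter) auto
  have "\<exists>p\<in>P. \<exists>a b. open_interval F a b \<noteq> {} \<and> open_interval F a b \<subseteq> ?U \<inter> C p"
  proof (rule finite_closed_cover[OF assms(1,2) U])
    have "x \<in> ?U" by blast
    then show "?U \<noteq> {}" by (metis empty_iff)
    show "?U \<subseteq> (\<Union>p\<in>P. C p)" by (simp add: assms(4))
  qed
  then obtain p a b where p: "p \<in> P" "open_interval F a b \<noteq> {}" "open_interval F a b \<subseteq> ?U \<inter> C p"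
    by (elim bexE exE conjE)
  then have "x \<in> C p" by blast
  with p show ?thesis by blast
qed

text \<open>The value group is either dense or discrete; in the discrete case the only value below the
  least positive one is zero.\<close>

lemma ex_small_value:
  assumes "v \<gamma> > 0" "\<delta> > 0"
  obtains g where "v g > 0" "\<And>z. \<bar>v z\<bar> < v g \<Longrightarrow> \<bar>v z\<bar> < \<delta>"
proof -
  define P where "P = {v a | a. v a > 0}"
  have P: "P \<noteq> {}" "bdd_below P" using assms(1) by (auto simp: P_def intro!: bdd_belowI[of _ 0])
  have PI: "v a \<in> P" if "v a > 0" for a using that by (auto simp: P_def)
  define l where "l = Inf P"
  have lower: "l \<le> r" if "r \<in> P" for r unfolding l_def using cInf_lower[OF that P(2)] .
  show ?thesis
  proof (cases "l < \<delta>")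
    case True
    then obtain r where "r \<in> P" "r < \<delta>" using P(1) unfolding l_def by (metis cInf_lessD)
    then show ?thesis using that by (fastforce simp: P_def)
  next
    case False
    \<comment> \<open>A positive value below \<open>v g\<close> would split \<open>v g\<close> into
      two positive values, each at least \<open>l\<close>, which is impossible for
      \<open>v g < 2 * l\<close>.\<close>
    then have "l < 2 * l" using assms(2) by simp
    then obtain r where "r \<in> P" "r < 2 * l" using P(1) cInf_lessD unfolding l_def by blast
    then obtain g where g: "v g > 0" "v g < 2 * l" by (auto simp: P_def)
    have "\<bar>v z\<bar> < \<delta>" if z: "\<bar>v z\<bar> < v g" for z
    proof (rule ccontr)
      assume n: "\<not> \<bar>v z\<bar> < \<delta>"
      obtain w where w: "v w = \<bar>v z\<bar>" using v_abs by blast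
      have "v w \<in> P" using n assms(2) w by (intro PI) simp
      moreover have "v (g * star F w) \<in> P" using z w by (intro PI) (simp add: v_mult v_star)
      ultimately show False using lower[of "v w"] lower[of "v (g * star F w)"] g by (simp add: v_mult v_star)
    qed
    then show ?thesis using that g(1) by blast
  qed
qed

lemma nu_open_affine:
  fixes r :: "'n::finite \<Rightarrow> real"
  assumes "v \<gamma> > 0"
  shows "nu_open {x. t + (\<Sum>i\<in>UNIV. r i * v (x i)) > 0}"
  unfolding nu_open_def
proof
  fix y assume y: "y \<in> {x. t + (\<Sum>i\<in>UNIV. r i * v (x i)) > 0}"
  \<comment> \<open>Moving each coordinate by at most \<open>\<delta>\<close> lowers the expression
    by at most \<open>\<delta>\<close> times the sum of the \<open>\<bar>r i\<bar>\<close>; the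
    summand 1 in the denominator leaves a remainder of \<open>\<delta>\<close>.\<close>
  define \<delta> where "\<delta> = (t + (\<Sum>i\<in>UNIV. r i * v (y i))) / (1 + (\<Sum>i\<in>UNIV. \<bar>r i\<bar>))"
  have "0 \<le> (\<Sum>i\<in>UNIV. \<bar>r i\<bar>)" by (intro sum_nonneg) simp
  then have s: "0 < 1 + (\<Sum>i\<in>UNIV. \<bar>r i\<bar>)" by linarith
  have \<delta>: "\<delta> > 0" using y unfolding \<delta>_def mem_Collect_eq by (rule divide_pos_pos[OF _ s])
  then obtain g where g: "v g > 0" "\<And>z. \<bar>v z\<bar> < v g \<Longrightarrow> \<bar>v z\<bar> < \<delta>"
    using ex_small_value assms by blast
  define a b where "a i = y i * star F g" and "b i = y i * g" for i
  have "y \<in> open_interval F a b" using g(1) by (simp add: mem_open_interval a_def b_def v_mult v_star)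
  moreover have "t + (\<Sum>i\<in>UNIV. r i * v (z i)) > 0" if "z \<in> open_interval F a b" for z
  proof -
    have "\<bar>v (z i * star F (y i))\<bar> < v g" for i
      using that by (auto simp: mem_open_interval a_def b_def v_mult v_star abs_less_iff algebra_simps)
    then have "\<bar>v (z i) - v (y i)\<bar> \<le> \<delta>" for i using g(2)[of "z i * star F (y i)"] by (simp add: v_mult v_star)
    then have "- (\<bar>r i\<bar> * \<delta>) \<le> r i * (v (z i) - v (y i))" for i
      using mult_left_mono[of "\<bar>v (z i) - v (y i)\<bar>" \<delta> "\<bar>r i\<bar>"] by (simp flip: abs_mult)
    then have "(\<Sum>i\<in>UNIV. - (\<bar>r i\<bar> * \<delta>)) \<le> (\<Sum>i\<in>UNIV. r i * (v (z i) - v (y i)))" by (intro sum_mono)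
    then have "- ((\<Sum>i\<in>UNIV. \<bar>r i\<bar>) * \<delta>) \<le> (\<Sum>i\<in>UNIV. r i * v (z i)) - (\<Sum>i\<in>UNIV. r i * v (y i))"
      by (simp add: sum_negf sum_distrib_right right_diff_distrib sum_subtractf)
    moreover have "(1 + (\<Sum>i\<in>UNIV. \<bar>r i\<bar>)) * \<delta> = t + (\<Sum>i\<in>UNIV. r i * v (y i))"
      using s by (simp add: \<delta>_def)
    then have "\<delta> + (\<Sum>i\<in>UNIV. \<bar>r i\<bar>) * \<delta> = t + (\<Sum>i\<in>UNIV. r i * v (y i))" by (simp add: distrib_right)
    ultimately show ?thesis using \<delta> by linarith
  qed
  ultimately show "\<exists>a b. y \<in> open_interval F a b \<and> open_interval F a b \<subseteq> {x. t + (\<Sum>i\<in>UNIV. r i * v (x i)) > 0}"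
    by blast
qed

lemma nu_open_mono_less:
  assumes "v \<gamma> > 0"
  shows "nu_open {x. trop_mono c e x < trop_mono d e' x}"
proof -
  have "{x. trop_mono c e x < trop_mono d e' x}
      = {x. (v d - v c) + (\<Sum>i\<in>UNIV. (real (e' i) - real (e i)) * v (x i)) > 0}"
    by (simp add: trop_mono_def left_diff_distrib sum_subtractf) (simp add: algebra_simps)
  then show ?thesis using nu_open_affine[OF assms] by simp
qed

section \<open>Laurent monomials and their kernels\<close>

lemma v_L_monomial:
  assumes "L_monomial F m"
  obtains c e where "\<exists>i. e i \<noteq> 0" "\<And>x. v (m x) = v c + (\<Sum>i\<in>UNIV. of_int (e i) * v (x i))"
proof -
  obtain c e where "\<exists>i. e i \<noteq> 0" "m = (\<lambda>x. c * (\<Prod>i\<in>UNIV. zpow F (x i) (e i)))"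
    using assms unfolding L_monomial_def by blast
  then show ?thesis by (intro that[of e c]) (simp_all add: v_mult v_prod v_zpow)
qed

lemma trop_rat_L_monomial:
  assumes "L_monomial F m"
  shows "(\<lambda>x. v (m x)) \<in> trop_rat"
proof -
  obtain c e where m: "\<And>x. v (m x) = v c + (\<Sum>i\<in>UNIV. of_int (e i) * v (x i))"
    using v_L_monomial[OF assms] by metis
  have "v (m x) = trop_mono c (\<lambda>i. nat (e i)) x - trop_mono 1 (\<lambda>i. nat (- e i)) x" for x
  proof -
    have "real_of_int (e i) = real (nat (e i)) - real (nat (- e i))" for i by simp
    then show ?thesis unfolding m by (simp add: trop_mono_def left_diff_distrib sum_subtractf)
  qed
  then show ?thesis using trop_rat_mono_diff by simp
qed

definition quot :: "'a \<Rightarrow> ('n::finite \<Rightarrow> nat) \<Rightarrow> 'a \<Rightarrow> ('n \<Rightarrow> nat) \<Rightarrow> ('n \<Rightarrow> 'a) \<Rightarrow> 'a" where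
  "quot c e d e' = (\<lambda>x. c * star F d * (\<Prod>i\<in>UNIV. zpow F (x i) (int (e i) - int (e' i))))"

lemma v_quot: "v (quot c e d e' x) = trop_mono c e x - trop_mono d e' x"
  by (simp add: quot_def trop_mono_def v_mult v_star v_prod v_zpow left_diff_distrib sum_subtractf)

lemma L_monomial_quot: "e \<noteq> e' \<Longrightarrow> L_monomial F (quot c e d e')"
  unfolding L_monomial_def quot_def
  by (intro exI[of _ "c * star F d"] exI[of _ "\<lambda>i. int (e i) - int (e' i)"]) auto

text \<open>The value of a generator of the product of the order kernels of the \<open>ms\<close>;
  it vanishes exactly where none of the monomials exceeds 1.\<close>

definition excess :: "(('n \<Rightarrow> 'a) \<Rightarrow> 'a) list \<Rightarrow> ('n \<Rightarrow> 'a) \<Rightarrow> real" where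
  "excess ms x = (\<Sum>m\<leftarrow>ms. max 0 (v (m x)))"

lemma excess_nonneg: "0 \<le> excess ms x"
  unfolding excess_def by (rule sum_list_nonneg) auto

lemma trop_rat_excess: "(\<And>m. m \<in> set ms \<Longrightarrow> L_monomial F m) \<Longrightarrow> excess ms \<in> trop_rat"
  unfolding excess_def by (intro trop_rat_sum_list trop_rat_max trop_rat_zero trop_rat_L_monomial)

lemma order_kernel_conv:
  assumes "L_monomial F m"
  shows "kernel_gen F {\<lambda>x. 1 + m x} = conv (\<lambda>x. max 0 (v (m x)))"
  using kernel_gen_conv[of "\<lambda>x. 1 + m x"] trop_rat_max[OF trop_rat_zero trop_rat_L_monomial[OF assms]]
  by (simp add: v_add)

lemma order_kernels_prod:
  assumes "\<And>m. m \<in> set ms \<Longrightarrow> L_monomial F m"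
  shows "kernel_prod F (map (\<lambda>m. kernel_gen F {\<lambda>x. 1 + m x}) ms) = conv (excess ms)"
proof -
  have "map (\<lambda>m. kernel_gen F {\<lambda>x. 1 + m x}) ms = map (\<lambda>m. conv (\<lambda>x. max 0 (v (m x)))) ms"
    using assms by (simp add: order_kernel_conv)
  also have "kernel_prod F \<dots> = conv (\<lambda>x. \<Sum>m\<leftarrow>ms. \<bar>max 0 (v (m x))\<bar>)"
    using assms by (intro kernel_prod_conv trop_rat_max trop_rat_zero trop_rat_L_monomial)
  finally show ?thesis by (simp add: excess_def[abs_def])
qed

lemma region_kernel_conv:
  assumes "\<And>m. m \<in> set ms \<Longrightarrow> L_monomial F m"
    and "open_interval F a b \<noteq> {}" "\<And>x. x \<in> open_interval F a b \<Longrightarrow> excess ms x = 0"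
  shows "region_kernel F (conv (excess ms))"
proof -
  obtain h where h: "h \<in> rational_funs F" "\<And>x. v (h x) = excess ms x" "kernel_gen F {h} = conv (excess ms)"
    using ex_generator[OF trop_rat_excess[OF assms(1)]] by blast
  have "region_fraction F h"
    unfolding region_fraction_def one_loc_def using h(1) assms(2,3)
    by (intro conjI exI[of _ a] exI[of _ b]) (auto simp: cong_iff h(2))
  moreover have "\<forall>K\<in>set (map (\<lambda>m. kernel_gen F {\<lambda>x. 1 + m x}) ms). order_kernel F K"
    using assms(1) unfolding order_kernel_def by auto
  ultimately show ?thesis unfolding region_kernel_def
    using h(3) order_kernels_prod[of ms, symmetric] assms(1) by blast
qed

text \<open>Moving one coordinate with nonzero exponent far enough brings \<open>m\<close> below 1,
  and by openness it stays there on an interval.\<close>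

lemma order_kernel_region:
  assumes m: "L_monomial F m" and \<gamma>: "v \<gamma> > 0"
  shows "region_kernel F (kernel_gen F {\<lambda>x. 1 + m x})"
proof -
  obtain c e where e: "\<exists>i. e i \<noteq> 0" and v: "\<And>x. v (m x) = v c + (\<Sum>i\<in>UNIV. of_int (e i) * v (x i))"
    using v_L_monomial[OF m] by metis
  obtain i where i: "e i \<noteq> 0" using e by blast
  obtain n :: nat where n: "v c < real n * v \<gamma>" using reals_Archimedean3[OF \<gamma>] by blast
  \<comment> \<open>The sign opposes that of \<open>e i\<close>, so \<open>m\<close> takes the value
    \<open>v c - \<bar>e i\<bar> * n * v \<gamma>\<close>, which is negative by the choice of
    \<open>n\<close>.\<close>
  define y where "y = (\<lambda>j. if j = i then zpow F \<gamma> (- sgn (e i) * int n) else 1)"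
  have "(\<Sum>j\<in>UNIV. real_of_int (e j) * v (y j)) = (\<Sum>j\<in>UNIV. if j = i then of_int (e i) * v (y i) else 0)"
    by (intro sum.cong) (auto simp: y_def)
  also have "\<dots> = of_int (e i * - sgn (e i) * int n) * v \<gamma>" by (simp add: y_def v_zpow)
  also have "e i * - sgn (e i) * int n = - (\<bar>e i\<bar> * int n)" by (simp add: abs_sgn)
  also have "of_int (- (\<bar>e i\<bar> * int n)) * v \<gamma> \<le> - (real n * v \<gamma>)"
  proof -
    have "1 * int n \<le> \<bar>e i\<bar> * int n" using i by (intro mult_right_mono) auto
    then have "real n \<le> of_int (\<bar>e i\<bar> * int n)" by linarith
    then have "real n * v \<gamma> \<le> of_int (\<bar>e i\<bar> * int n) * v \<gamma>" using \<gamma> by (intro mult_right_mono) auto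
    then show ?thesis by simp
  qed
  finally have y: "v (m y) < 0" using n v by simp
  have eq: "{x. v (m x) < 0} = {x. - v c + (\<Sum>i\<in>UNIV. - of_int (e i) * v (x i)) > 0}"
    unfolding v by (auto simp: sum_negf)
  have "nu_open {x. v (m x) < 0}" unfolding eq by (rule nu_open_affine[OF \<gamma>])
  with y obtain a b where ab: "y \<in> open_interval F a b" "open_interval F a b \<subseteq> {x. v (m x) < 0}"
    by (auto elim: nu_openD)
  have "region_kernel F (conv (excess [m]))"
  proof (rule region_kernel_conv)
    show "excess [m] x = 0" if "x \<in> open_interval F a b" for x
      using that ab(2) by (auto simp: excess_def max_def)
  qed (use m ab in auto)
  moreover have "excess [m] = (\<lambda>x. max 0 (v (m x)))" by (simp add: excess_def fun_eq_iff)
  ultimately show ?thesis using order_kernel_conv[OF m] by simp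
qed

text \<open>A monomial and its absolute value generate the same kernel, and non-proportionality is
  vacuous for a single monomial.\<close>

lemma HP_kernel_HS:
  assumes "L_monomial F m"
  shows "HS_kernel F (kernel_gen F {m})"
proof -
  have r: "(\<lambda>x. v (m x)) \<in> trop_rat" by (rule trop_rat_L_monomial[OF assms])
  obtain h where h: "h \<in> rational_funs F" "\<And>x. v (h x) = v (m x)" "kernel_gen F {h} = conv (\<lambda>x. v (m x))"
    using ex_generator[OF r] by blast
  have "kernel_gen F {\<lambda>x. nu_abs F (m x)} = conv (\<lambda>x. \<bar>v (m x)\<bar>)"
    using kernel_gen_conv[of "\<lambda>x. nu_abs F (m x)"] trop_rat_abs[OF r] by (simp add: v_abs)
  also have "\<dots> = conv (\<lambda>x. v (m x))" by (rule conv_cong) simp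
  finally have "HS_fraction F h"
    unfolding HS_fraction_def frac_equiv_def using h assms by (auto intro!: exI[of _ "[m]"])
  then show ?thesis unfolding HS_kernel_def using h(3) kernel_gen_conv[OF r] by auto
qed

lemma const_bounded_below:
  assumes "v c \<noteq> 0"
  shows "bounded_below_kernel F (conv (\<lambda>x :: 'n::finite \<Rightarrow> 'a. v c))"
proof -
  obtain h :: "('n \<Rightarrow> 'a) \<Rightarrow> 'a" where h: "h \<in> rational_funs F" "\<And>x. v (h x) = v c" "kernel_gen F {h} = conv (\<lambda>x. v c)"
    using ex_generator[OF trop_rat_const] by metis
  then have "nu_less F 1 (nu_abs F c)" "\<forall>x. nu_le F (nu_abs F c) (nu_abs F (h x))"
    using assms by (simp_all add: less_iff le_iff v_abs)
  then show ?thesis unfolding bounded_below_kernel_def h(3)[symmetric]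
    using h(1) by (intro bexI[of _ h] conjI exI[of _ "nu_abs F c"]) simp_all
qed

end

section \<open>The decomposition\<close>

text \<open>The condition on each \<open>K i\<close> in the theorem. Empty lists stand for trivial
  factors, since \<open>HS_kernel\<close> asks for at least one monomial and
  \<open>region_kernel\<close> for a nonempty interval.\<close>

definition HS_region_product ::
    "('a::{comm_semiring, comm_monoid_mult}, 'z) nu_structure_scheme \<Rightarrow> (('n::finite \<Rightarrow> 'a) \<Rightarrow> 'a) set \<Rightarrow> bool" where
  "HS_region_product F K \<longleftrightarrow> principal_kernel F K \<and>
     (\<exists>L R Ls Os.
        K = kernel_mult F L R \<and>
        L = kernel_prod F Ls \<and> (\<forall>H\<in>set Ls. HP_kernel F H) \<and> (Ls = [] \<or> HS_kernel F L) \<and>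
        R = kernel_prod F Os \<and> (\<forall>H\<in>set Os. order_kernel F H) \<and> (Os = [] \<or> region_kernel F R))"

definition bounded_region_product ::
    "('a::{comm_semiring, comm_monoid_mult}, 'z) nu_structure_scheme \<Rightarrow> (('n::finite \<Rightarrow> 'a) \<Rightarrow> 'a) set \<Rightarrow> bool" where
  "bounded_region_product F N \<longleftrightarrow> principal_kernel F N \<and>
     (\<exists>Bs Rs.
        N = kernel_mult F (kernel_prod F Bs) (kernel_prod F Rs) \<and>
        Bs \<noteq> [] \<and> (\<forall>B\<in>set Bs. bounded_below_kernel F B) \<and>
        (\<forall>R\<in>set Rs. region_kernel F R))"

context nu_valuation
begin

text \<open>At most one HP-factor occurs, as each pair of monomials contributes a single quotient.
  The alternative \<open>ms = []\<close> serves the trivial value group, which has no nonempty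
  intervals.\<close>

lemma HS_region_product_conv:
  assumes ls: "length ls \<le> 1" "\<And>m. m \<in> set ls \<Longrightarrow> L_monomial F m"
    and ms: "\<And>m. m \<in> set ms \<Longrightarrow> L_monomial F m"
    and region: "ms = [] \<or> (\<exists>a b. open_interval F a b \<noteq> {} \<and> (\<forall>x\<in>open_interval F a b. excess ms x = 0))"
    and \<phi>: "\<And>x. \<phi> x = (\<Sum>l\<leftarrow>ls. \<bar>v (l x)\<bar>) + excess ms x"
  shows "HS_region_product F (conv \<phi>)"
proof -
  let ?Ls = "map (\<lambda>l. kernel_gen F {l}) ls"
  let ?Os = "map (\<lambda>m. kernel_gen F {\<lambda>x. 1 + m x}) ms"
  have lr: "(\<lambda>x. \<Sum>l\<leftarrow>ls. \<bar>v (l x)\<bar>) \<in> trop_rat"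
    using ls(2) by (intro trop_rat_sum_list trop_rat_abs trop_rat_L_monomial)
  have "?Ls = map (\<lambda>l. conv (\<lambda>x. v (l x))) ls"
    using ls(2) by (simp add: kernel_gen_conv trop_rat_L_monomial)
  also have "kernel_prod F \<dots> = conv (\<lambda>x. \<Sum>l\<leftarrow>ls. \<bar>v (l x)\<bar>)"
    by (intro kernel_prod_conv trop_rat_L_monomial ls(2))
  finally have L: "kernel_prod F ?Ls = conv (\<lambda>x. \<Sum>l\<leftarrow>ls. \<bar>v (l x)\<bar>)" .
  have R: "kernel_prod F ?Os = conv (excess ms)" using ms by (rule order_kernels_prod)
  have er: "excess ms \<in> trop_rat" using ms by (rule trop_rat_excess)
  have "0 \<le> (\<Sum>l\<leftarrow>ls. \<bar>v (l x)\<bar>)" for x by (rule sum_list_nonneg) auto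
  then have "\<bar>\<phi> x\<bar> = \<bar>\<bar>\<Sum>l\<leftarrow>ls. \<bar>v (l x)\<bar>\<bar> + \<bar>excess ms x\<bar>\<bar>" for x
    by (simp add: \<phi> excess_nonneg)
  then have "conv \<phi> = kernel_mult F (kernel_prod F ?Ls) (kernel_prod F ?Os)"
    unfolding L R kernel_mult_conv[OF lr er] by (rule conv_cong)
  moreover have "principal_kernel F (conv \<phi>)"
    using trop_rat_add[OF lr er] by (intro principal_conv) (simp add: \<phi>[abs_def])
  moreover have "?Ls = [] \<or> HS_kernel F (kernel_prod F ?Ls)"
  proof (cases ls)
    case (Cons l ls')
    then have l: "ls = [l]" "L_monomial F l" using ls by auto
    have "conv (\<lambda>x. \<Sum>l\<leftarrow>ls. \<bar>v (l x)\<bar>) = conv (\<lambda>x. v (l x))" by (rule conv_cong) (simp add: l)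
    then show ?thesis using HP_kernel_HS[OF l(2)] L kernel_gen_conv[OF trop_rat_L_monomial[OF l(2)]] by simp
  qed simp
  moreover have "?Os = [] \<or> region_kernel F (kernel_prod F ?Os)"
    using region region_kernel_conv[OF ms] unfolding R by blast
  moreover have "\<forall>H\<in>set ?Ls. HP_kernel F H" using ls(2) unfolding HP_kernel_def by auto
  moreover have "\<forall>H\<in>set ?Os. order_kernel F H" using ms unfolding order_kernel_def by auto
  ultimately show ?thesis unfolding HS_region_product_def by blast
qed

text \<open>The nonzero value of \<open>c\<close> makes the value group nontrivial, so each order
  kernel is a region kernel by itself.\<close>

lemma bounded_region_product_conv:
  fixes \<phi> :: "('n::finite \<Rightarrow> 'a) \<Rightarrow> real"
  assumes c: "v c \<noteq> 0"
    and ms: "\<And>m. m \<in> set ms \<Longrightarrow> L_monomial F m"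
    and \<phi>: "\<And>x. \<phi> x = \<bar>v c\<bar> + excess ms x"
  shows "bounded_region_product F (conv \<phi>)"
proof -
  let ?B = "conv (\<lambda>x. v c)"
  let ?Rs = "map (\<lambda>m. kernel_gen F {\<lambda>x. 1 + m x}) ms"
  have "kernel_prod F (map (\<lambda>c. conv (\<lambda>x. v c)) [c]) = conv (\<lambda>x. \<Sum>c\<leftarrow>[c]. \<bar>v c\<bar>)"
    by (intro kernel_prod_conv trop_rat_const)
  then have B: "kernel_prod F [?B] = conv (\<lambda>x. \<bar>v c\<bar>)" by simp
  have R: "kernel_prod F ?Rs = conv (excess ms)" using ms by (rule order_kernels_prod)
  have er: "excess ms \<in> trop_rat" using ms by (rule trop_rat_excess)
  have cr: "(\<lambda>x :: 'n \<Rightarrow> 'a. \<bar>v c\<bar>) \<in> trop_rat" by (intro trop_rat_abs trop_rat_const)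
  have "\<bar>\<phi> x\<bar> = \<bar>\<bar>\<bar>v c\<bar>\<bar> + \<bar>excess ms x\<bar>\<bar>" for x
    by (simp add: \<phi> excess_nonneg)
  then have "conv \<phi> = kernel_mult F (kernel_prod F [?B]) (kernel_prod F ?Rs)"
    unfolding B R kernel_mult_conv[OF cr er] by (rule conv_cong)
  moreover have "principal_kernel F (conv \<phi>)"
    using trop_rat_add[OF cr er] by (intro principal_conv) (simp add: \<phi>[abs_def])
  moreover have "v (nu_abs F c) > 0" using c by (simp add: v_abs)
  then have "\<forall>R\<in>set ?Rs. region_kernel F R" using order_kernel_region ms by auto
  moreover have "\<forall>B\<in>set [?B]. bounded_below_kernel F B" using const_bounded_below[OF c] by simp
  ultimately show ?thesis unfolding bounded_region_product_def by blast
qed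

lemma conv_const_kernel:
  assumes "h \<in> const_kernel F" "c > 0" "\<And>x. c \<le> \<phi> x"
  shows "h \<in> conv \<phi>"
proof -
  obtain C where C: "\<And>x. \<bar>v (h x)\<bar> \<le> C" using const_kernel_bounded(2)[OF assms(1)] by blast
  obtain k :: nat where k: "C < real k * c" using reals_Archimedean3[OF assms(2)] by blast
  have "\<bar>v (h x)\<bar> \<le> real k * \<bar>\<phi> x\<bar>" for x
    using C[of x] k mult_left_mono[of c "\<bar>\<phi> x\<bar>" "real k"] assms(3)[of x] by linarith
  then show ?thesis using const_kernel_bounded(1)[OF assms(1)] by (intro convI)
qed

text \<open>On the region where the monomials \<open>i\<close> of the numerator and \<open>j\<close> of the denominator dominate,
  \<open>f\<close> is their quotient; the excess over these monomials makes up for the difference elsewhere.\<close>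

lemma kernel_decomposition:
  fixes f :: "('n::finite \<Rightarrow> 'a) \<Rightarrow> 'a"
  assumes f: "f \<in> rational_funs F"
  shows "\<exists>\<K> \<N>. finite \<K> \<and> finite \<N> \<and> \<K> \<union> \<N> \<noteq> {} \<and>
    (\<forall>K\<in>\<K>. HS_region_product F K) \<and> (\<forall>N\<in>\<N>. bounded_region_product F N) \<and>
    kernel_gen F {f} = \<Inter>\<K> \<inter> \<Inter>\<N> \<and>
    (\<N> \<noteq> {} \<longrightarrow> kernel_gen F {f} \<subseteq> const_kernel F \<longrightarrow> kernel_gen F {f} = \<Inter>\<K> \<inter> const_kernel F)"
proof (cases "\<exists>\<gamma>. v \<gamma> > 0")
  case False
  \<comment> \<open>With only the value 0, every generated kernel is the trivial one, an empty
    product.\<close>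
  have v0: "v a = 0" for a using False v_star by (metis linorder_neqE_linordered_idom neg_0_less_iff_less)
  have "HS_region_product F (conv (\<lambda>x. 0))"
    by (rule HS_region_product_conv[of "[]" "[]"]) (simp_all add: excess_def)
  moreover have "kernel_gen F {f} = conv (\<lambda>x. 0)"
    using kernel_gen_conv[OF rational_trop_rat[OF f]] v0 by simp
  ultimately show ?thesis by (intro exI[of _ "{kernel_gen F {f}}"] exI[of _ "{}"]) simp
next
  case True
  then obtain \<gamma> where \<gamma>: "v \<gamma> > 0" by blast
  have "(\<lambda>x. v (f x)) \<in> trop_rat" by (rule rational_trop_rat[OF f])
  then obtain p q where "p \<in> trop_poly" "q \<in> trop_poly" and fpq: "\<And>x. v (f x) = p x - q x"
    unfolding trop_rat_iff by (metis (no_types, lifting))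
  then obtain E c D d where E: "finite E" "E \<noteq> {}" "\<And>x. p x = Max ((\<lambda>e. trop_mono (c e) e x) ` E)"
    and D: "finite D" "D \<noteq> {}" "\<And>x. q x = Max ((\<lambda>e. trop_mono (d e) e x) ` D)"
    unfolding trop_poly_def by blast
  obtain Es Ds where Es: "set Es = E" and Ds: "set Ds = D" using finite_list[OF E(1)] finite_list[OF D(1)] by blast
  have p_ge: "trop_mono (c i) i x \<le> p x" if "i \<in> E" for i x unfolding E(3) using E(1) that by simp
  have q_ge: "trop_mono (d j) j x \<le> q x" if "j \<in> D" for j x unfolding D(3) using D(1) that by simp
  have p_att: "\<exists>i\<in>E. p x = trop_mono (c i) i x" for x
    using Max_in[of "(\<lambda>e. trop_mono (c e) e x) ` E"] E by (auto simp: image_iff)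
  have q_att: "\<exists>j\<in>D. q x = trop_mono (d j) j x" for x
    using Max_in[of "(\<lambda>e. trop_mono (d e) e x) ` D"] D by (auto simp: image_iff)
  \<comment> \<open>Quotients of the competing monomials by the monomials \<open>i\<close> and
    \<open>j\<close>; the filters ensure that exponents differ, so that these are
    L-monomials.\<close>
  define ms where "ms i j = map (\<lambda>i'. quot (c i') i' (c i) i) (filter (\<lambda>i'. i' \<noteq> i) Es)
    @ map (\<lambda>j'. quot (d j') j' (d j) j) (filter (\<lambda>j'. j' \<noteq> j) Ds)" for i j
  have ms: "L_monomial F m" if "m \<in> set (ms i j)" for m i j
    using that by (auto simp: ms_def L_monomial_quot)
  define C where "C = (\<lambda>(i, j). {x. trop_mono (c i) i x = p x \<and> trop_mono (d j) j x = q x})"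
  have excess: "excess (ms i j) x = (\<Sum>i'\<leftarrow>filter (\<lambda>i'. i' \<noteq> i) Es. max 0 (trop_mono (c i') i' x - trop_mono (c i) i x))
      + (\<Sum>j'\<leftarrow>filter (\<lambda>j'. j' \<noteq> j) Ds. max 0 (trop_mono (d j') j' x - trop_mono (d j) j x))" for i j x
    by (simp add: excess_def ms_def v_quot comp_def)
  have excess_C: "excess (ms i j) x = 0" if "x \<in> C (i, j)" for i j x
  proof -
    have "max 0 (trop_mono (c i') i' x - trop_mono (c i) i x) = 0" if "i' \<in> set Es" for i'
      using p_ge[of i' x] \<open>x \<in> C (i, j)\<close> that Es by (simp add: C_def)
    then have "(\<Sum>i'\<leftarrow>filter (\<lambda>i'. i' \<noteq> i) Es. max 0 (trop_mono (c i') i' x - trop_mono (c i) i x)) = (\<Sum>_\<leftarrow>filter (\<lambda>i'. i' \<noteq> i) Es. 0)"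
      by (intro arg_cong[where f = sum_list] map_cong refl) simp
    moreover have "max 0 (trop_mono (d j') j' x - trop_mono (d j) j x) = 0" if "j' \<in> set Ds" for j'
      using q_ge[of j' x] \<open>x \<in> C (i, j)\<close> that Ds by (simp add: C_def)
    then have "(\<Sum>j'\<leftarrow>filter (\<lambda>j'. j' \<noteq> j) Ds. max 0 (trop_mono (d j') j' x - trop_mono (d j) j x)) = (\<Sum>_\<leftarrow>filter (\<lambda>j'. j' \<noteq> j) Ds. 0)"
      by (intro arg_cong[where f = sum_list] map_cong refl) simp
    ultimately show ?thesis unfolding excess by (simp only: sum_list_0 add_0)
  qed
  have dominate: "g i' - g i \<le> (\<Sum>k\<leftarrow>filter (\<lambda>k. k \<noteq> i) ks. max 0 (g k - g i))"
    if "i' \<in> set ks" for g :: "('n \<Rightarrow> nat) \<Rightarrow> real" and i i' ks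
  proof (cases "i' = i")
    case True
    then show ?thesis by (auto intro!: sum_list_nonneg)
  next
    case False
    then have "max 0 (g i' - g i) \<le> (\<Sum>k\<leftarrow>filter (\<lambda>k. k \<noteq> i) ks. max 0 (g k - g i))"
      using that by (intro member_le_sum_list) auto
    then show ?thesis by simp
  qed
  define \<psi> where "\<psi> = (\<lambda>(i, j) x. \<bar>trop_mono (c i) i x - trop_mono (d j) j x\<bar> + excess (ms i j) x)"
  \<comment> \<open>On an interval inside the cell the excess vanishes, as required of a region
    kernel.\<close>
  define G where "G = {ij \<in> E \<times> D. \<exists>a b. open_interval F a b \<noteq> {} \<and> open_interval F a b \<subseteq> C ij}"
  have finG: "finite G" using E(1) D(1) by (simp add: G_def)
  have upper: "\<bar>v (f x)\<bar> \<le> \<bar>\<psi> ij x\<bar>" if "ij \<in> G" for ij x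
  proof -
    obtain i j where ij: "ij = (i, j)" "i \<in> E" "j \<in> D" using \<open>ij \<in> G\<close> by (auto simp: G_def)
    obtain i' where i': "i' \<in> E" "p x = trop_mono (c i') i' x" using p_att by blast
    obtain j' where j': "j' \<in> D" "q x = trop_mono (d j') j' x" using q_att by blast
    \<comment> \<open>By the triangle inequality, passing from \<open>p - q\<close> to the monomials
      \<open>i\<close> and \<open>j\<close> costs at most these two nonnegative differences, and the
      excess pays for them.\<close>
    have "(p x - trop_mono (c i) i x) + (q x - trop_mono (d j) j x) \<le> excess (ms i j) x"
      unfolding excess i'(2) j'(2)
      using dominate[of i' Es "\<lambda>i. trop_mono (c i) i x" i] dominate[of j' Ds "\<lambda>j. trop_mono (d j) j x" j] i'(1) j'(1) Es Ds
      by simp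
    then show ?thesis using p_ge[OF ij(2), of x] q_ge[OF ij(3), of x] by (simp add: \<psi>_def ij(1) fpq)
  qed
  have open_C: "nu_open (- C ij)" if "ij \<in> E \<times> D" for ij
  proof -
    obtain i j where ij: "ij = (i, j)" "i \<in> E" "j \<in> D" using \<open>ij \<in> E \<times> D\<close> by blast
    have "- C ij = \<Union>((\<lambda>i'. {x. trop_mono (c i) i x < trop_mono (c i') i' x}) ` E \<union> (\<lambda>j'. {x. trop_mono (d j) j x < trop_mono (d j') j' x}) ` D)"
      (is "_ = ?U")
    proof (intro set_eqI iffI)
      fix x assume "x \<in> - C ij"
      then have "trop_mono (c i) i x < p x \<or> trop_mono (d j) j x < q x"
        using p_ge[OF ij(2), of x] q_ge[OF ij(3), of x] by (auto simp: C_def ij(1))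
      then show "x \<in> ?U" using p_att[of x] q_att[of x] by force
    next
      fix x assume "x \<in> ?U"
      then show "x \<in> - C ij" using p_ge[of _ x] q_ge[of _ x] by (force simp: C_def ij(1))
    qed
    moreover have "nu_open ?U" by (rule nu_open_Union) (use nu_open_mono_less[OF \<gamma>] in auto)
    ultimately show ?thesis by simp
  qed
  \<comment> \<open>With zero exponents the inequality reads \<open>0 < v \<gamma>\<close> and
    describes the whole space.\<close>
  have "nu_open {x. trop_mono 1 (\<lambda>_. 0) x < trop_mono \<gamma> (\<lambda>_ :: 'n. 0) x}" by (rule nu_open_mono_less[OF \<gamma>])
  then have "nu_open (UNIV :: ('n \<Rightarrow> 'a) set)" using \<gamma> by (simp add: trop_mono_def)
  moreover have "x \<in> (\<Union>ij\<in>E \<times> D. C ij)" for x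
  proof -
    obtain i where i: "i \<in> E" "p x = trop_mono (c i) i x" using p_att by blast
    obtain j where j: "j \<in> D" "q x = trop_mono (d j) j x" using q_att by blast
    show ?thesis using i j by (intro UN_I[of "(i, j)"]) (simp_all add: C_def)
  qed
  then have "(\<Union>ij\<in>E \<times> D. C ij) = UNIV" by (rule UNIV_eq_I[symmetric])
  \<comment> \<open>Every point lies in a cell that contains an interval, so restricting to
    \<open>G\<close> loses no point.\<close>
  ultimately have cover: "\<exists>ij\<in>E \<times> D. x \<in> C ij \<and> (\<exists>a b. open_interval F a b \<noteq> {} \<and> open_interval F a b \<subseteq> C ij)" for x
    using E(1) D(1) open_C by (intro local_closed_cover) auto
  have attained: "\<exists>ij\<in>G. \<bar>\<psi> ij x\<bar> = \<bar>v (f x)\<bar>" for x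
  proof -
    obtain ij where ij: "ij \<in> G" "x \<in> C ij" using cover[of x] unfolding G_def mem_Collect_eq by blast
    obtain i j where "ij = (i, j)" by (rule prod.exhaust)
    then have "\<bar>\<psi> ij x\<bar> = \<bar>v (f x)\<bar>" using ij(2) excess_C[of x i j] by (simp add: \<psi>_def C_def fpq)
    then show ?thesis using ij(1) by blast
  qed
  have gen: "kernel_gen F {f} = (\<Inter>ij\<in>G. conv (\<psi> ij))"
    unfolding kernel_gen_conv[OF rational_trop_rat[OF f]]
    by (rule conv_Inter[OF finG rational_trop_rat[OF f] upper attained])
  \<comment> \<open>Pairs whose quotient is a constant of nonzero value; they give the
    \<open>N j\<close>. Equal exponents with equal values leave a pure product of order kernels,
    which belongs to the \<open>K i\<close>.\<close>
  define B where "B = {(i, j) \<in> G. i = j \<and> v (c i) \<noteq> v (d j)}"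
  have HS: "HS_region_product F (conv (\<psi> ij))" if mem: "ij \<in> G - B" for ij
  proof -
    obtain i j where ij: "ij = (i, j)" by (rule prod.exhaust)
    obtain a b where ab: "open_interval F a b \<noteq> {}" "open_interval F a b \<subseteq> C (i, j)"
      using mem unfolding G_def ij by blast
    then have region: "\<exists>a b. open_interval F a b \<noteq> {} \<and> (\<forall>x\<in>open_interval F a b. excess (ms i j) x = 0)"
      using excess_C by blast
    show ?thesis
    proof (cases "i = j")
      case True
      then have "v (c i) = v (d j)" using mem by (auto simp: B_def ij)
      then have "\<psi> ij x = (\<Sum>l\<leftarrow>[]. \<bar>v (l x)\<bar>) + excess (ms i j) x" for x
        using True by (simp add: \<psi>_def ij trop_mono_def)
      then show ?thesis using region ms by (intro HS_region_product_conv[of "[]" "ms i j"]) auto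
    next
      case False
      have "\<psi> ij x = (\<Sum>l\<leftarrow>[quot (c i) i (d j) j]. \<bar>v (l x)\<bar>) + excess (ms i j) x" for x
        by (simp add: \<psi>_def ij v_quot)
      then show ?thesis using region ms L_monomial_quot[OF False]
        by (intro HS_region_product_conv[of "[quot (c i) i (d j) j]" "ms i j"]) auto
    qed
  qed
  have B_const: "\<exists>b. v b \<noteq> 0 \<and> (\<forall>x. \<psi> ij x = \<bar>v b\<bar> + excess (ms (fst ij) (snd ij)) x)" if "ij \<in> B" for ij
    using that by (auto simp: B_def \<psi>_def trop_mono_def v_mult v_star intro!: exI[of _ "c (snd ij) * star F (d (snd ij))"])
  have bounded: "bounded_region_product F (conv (\<psi> ij))" if "ij \<in> B" for ij
  proof -
    obtain b where "v b \<noteq> 0" "\<And>x. \<psi> ij x = \<bar>v b\<bar> + excess (ms (fst ij) (snd ij)) x"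
      using B_const[OF \<open>ij \<in> B\<close>] by blast
    then show ?thesis using ms by (intro bounded_region_product_conv)
  qed
  show ?thesis
  proof (rule exI[of _ "(\<lambda>ij. conv (\<psi> ij)) ` (G - B)"], rule exI[of _ "(\<lambda>ij. conv (\<psi> ij)) ` B"],
      intro conjI impI)
    have "B \<subseteq> G" by (auto simp: B_def)
    then have GB: "G = (G - B) \<union> B" by blast
    show "finite ((\<lambda>ij. conv (\<psi> ij)) ` (G - B))" "finite ((\<lambda>ij. conv (\<psi> ij)) ` B)"
      using finG \<open>B \<subseteq> G\<close> finite_subset by auto
    have "G \<noteq> {}" using attained by blast
    then show "(\<lambda>ij. conv (\<psi> ij)) ` (G - B) \<union> (\<lambda>ij. conv (\<psi> ij)) ` B \<noteq> {}" using GB by blast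
    show eq: "kernel_gen F {f} = \<Inter>((\<lambda>ij. conv (\<psi> ij)) ` (G - B)) \<inter> \<Inter>((\<lambda>ij. conv (\<psi> ij)) ` B)"
      unfolding gen by (subst GB) blast
    assume const: "kernel_gen F {f} \<subseteq> const_kernel F"
    show "kernel_gen F {f} = \<Inter>((\<lambda>ij. conv (\<psi> ij)) ` (G - B)) \<inter> const_kernel F"
    proof
      show "kernel_gen F {f} \<subseteq> \<Inter>((\<lambda>ij. conv (\<psi> ij)) ` (G - B)) \<inter> const_kernel F" using eq const by blast
      \<comment> \<open>Here \<open>\<psi> ij\<close> is bounded below by a positive constant while
        elements of \<open>const_kernel F\<close> are bounded, so a multiple of
        \<open>\<psi> ij\<close> dominates them. Hence replacing the \<open>N j\<close> can only
        shrink the intersection.\<close>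
      have "const_kernel F \<subseteq> conv (\<psi> ij)" if "ij \<in> B" for ij
      proof
        fix h :: "('n \<Rightarrow> 'a) \<Rightarrow> 'a" assume h: "h \<in> const_kernel F"
        obtain b where b: "v b \<noteq> 0" "\<And>x. \<psi> ij x = \<bar>v b\<bar> + excess (ms (fst ij) (snd ij)) x"
          using B_const[OF \<open>ij \<in> B\<close>] by blast
        show "h \<in> conv (\<psi> ij)"
        proof (rule conv_const_kernel)
          show "\<bar>v b\<bar> \<le> \<psi> ij x" for x using b(2) excess_nonneg by simp
        qed (use h b(1) in auto)
      qed
      then show "\<Inter>((\<lambda>ij. conv (\<psi> ij)) ` (G - B)) \<inter> const_kernel F \<subseteq> kernel_gen F {f}" unfolding eq by blast
    qed
  qed (use HS bounded in auto)
qed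

end

section \<open>The decomposition with numbered factors\<close>

theorem theorem9p4p8:
  fixes F :: "'a::{comm_semiring, comm_monoid_mult} nu_structure"
    and f :: "('n::finite \<Rightarrow> 'a) \<Rightarrow> 'a"
  assumes "nu_semifield F" and "nu_bipotent F" and "nu_archimedean F"
    and "f \<in> rational_funs F"
  shows "\<exists>(q::nat) (m::nat) (K :: nat \<Rightarrow> (('n \<Rightarrow> 'a) \<Rightarrow> 'a) set) (N :: nat \<Rightarrow> (('n \<Rightarrow> 'a) \<Rightarrow> 'a) set).
     0 < q + m \<and>
     (\<forall>i<q. principal_kernel F (K i) \<and>
        (\<exists>L R Ls Os.
           K i = kernel_mult F L R \<and>
           L = kernel_prod F Ls \<and> (\<forall>H\<in>set Ls. HP_kernel F H) \<and> (Ls = [] \<or> HS_kernel F L) \<and>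
           R = kernel_prod F Os \<and> (\<forall>H\<in>set Os. order_kernel F H) \<and> (Os = [] \<or> region_kernel F R))) \<and>
     (\<forall>j<m. principal_kernel F (N j) \<and>
        (\<exists>Bs Rs.
           N j = kernel_mult F (kernel_prod F Bs) (kernel_prod F Rs) \<and>
           Bs \<noteq> [] \<and> (\<forall>B\<in>set Bs. bounded_below_kernel F B) \<and>
           (\<forall>R\<in>set Rs. region_kernel F R))) \<and>
     kernel_gen F {f} = (\<Inter>i<q. K i) \<inter> (\<Inter>j<m. N j) \<and>
     (kernel_gen F {f} \<subseteq> const_kernel F \<longrightarrow>
        kernel_gen F {f} = (\<Inter>i<q. K i) \<inter> (\<Inter>j<m. const_kernel F))"
proof -
  obtain v where "nu_valuation F v" using ex_valuation assms(1-3) by blast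
  then interpret nu_valuation F v .
  obtain \<K> \<N> where fin: "finite \<K>" "finite \<N>" and ne: "\<K> \<union> \<N> \<noteq> {}"
    and K: "\<forall>K\<in>\<K>. HS_region_product F K" and N: "\<forall>N\<in>\<N>. bounded_region_product F N"
    and eq: "kernel_gen F {f} = \<Inter>\<K> \<inter> \<Inter>\<N>"
    and const: "\<N> \<noteq> {} \<longrightarrow> kernel_gen F {f} \<subseteq> const_kernel F \<longrightarrow> kernel_gen F {f} = \<Inter>\<K> \<inter> const_kernel F"
    using kernel_decomposition[OF assms(4)] by (elim exE conjE) (rule that)
  obtain q :: nat and k where k: "\<K> = k ` {..<q}"
    using fin(1) unfolding finite_conv_nat_seg_image lessThan_def by blast
  obtain m :: nat and n where n: "\<N> = n ` {..<m}"
    using fin(2) unfolding finite_conv_nat_seg_image lessThan_def by blast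
  have "0 < q + m" using ne unfolding k n by (cases q; cases m) auto
  moreover have "\<forall>i<q. HS_region_product F (k i)" "\<forall>j<m. bounded_region_product F (n j)"
    using K N unfolding k n by auto
  moreover have "kernel_gen F {f} = (\<Inter>i<q. k i) \<inter> (\<Inter>j<m. n j)" using eq unfolding k n by simp
  moreover have "kernel_gen F {f} \<subseteq> const_kernel F \<longrightarrow> kernel_gen F {f} = (\<Inter>i<q. k i) \<inter> (\<Inter>j<m. const_kernel F)"
  \<comment> \<open>For \<open>m = 0\<close> the intersection over an empty index set is everything,
    and the claim is the decomposition itself.\<close>
  proof (cases "m = 0")
    case True
    then show ?thesis using eq unfolding k n by simp
  next
    case False
    then have "\<N> \<noteq> {}" "(\<Inter>j<m. const_kernel F) = (const_kernel F :: (('n \<Rightarrow> 'a) \<Rightarrow> 'a) set)" unfolding n by auto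
    then show ?thesis using const unfolding k by simp
  qed
  ultimately show ?thesis
    unfolding HS_region_product_def bounded_region_product_def
    by (intro exI[of _ q] exI[of _ m] exI[of _ k] exI[of _ n] conjI)
qed

end
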